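(* Let $(X_t,\mathcal{F}_t,\mathbf{P}_x)$ be a one-dimensional diffusion on the canonical space as in the context whose part on $S$ is a recurrent strong Markov process. Let $Z\colon(\Omega,\mathcal{F}_{\tau_2})\to(\mathbb{R},\mathcal{B}(\mathbb{R}))$ be measurable, bounded below, with $Z\in\bigcap_{d\in\mathtt{D}}L^2(\mathbf{P}_d)$ and $\mathbf{E}_d(Z)=0$ for all $d\in\mathtt{D}$. Let $Z_1=Z$ and $Z_n=Z\circ\mathrm{sh}_{\tau_n}$ for $n\ge2$. Then for any initial probability measure $\mu$ on $S$, under $\mathbf{P}_\mu=\int\mathbf{P}_x\,d\mu(x)$ the distribution of $$n^{-1/2}\sum_{k=1}^nZ_k$$ converges to the normal distribution with mean zero and variance $\sigma^2=\sum_{d\in\mathtt{D}}p_d\,\mathbf{E}_d(Z^2)$, where $p=(p_d)$ is the left-fixed probability row vector of the Markov chain $(X_{\tau_n},\mathcal{F}_{\tau_n})$.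
   Context: $S$ is one of $\mathbb{R}$, $[0,\infty)$, $(0,\infty)$; $\Omega=C([0,\infty);S)$, $X_t$ the coordinate process, $\mathcal{F}_t=\sigma(X_u:u\le t)$. $\mathtt{D}=\{d_1<\dots<d_s\}\subset S$ finite ($s\ge2$); $\tau_1=\inf\{t\ge0:X_t\in\mathtt{D}\}$, $\tau_{n+1}=\inf\{t\ge\tau_n:X_t\in\mathtt{D}\setminus\{X_{\tau_n}\}\}$. For a stopping time $\tau$, $\mathrm{sh}_\tau(\omega)(\cdot)=\omega(\tau(\omega)+\cdot)$ is the shift. The chain $(X_{\tau_n})$ on $\mathtt{D}$ has irreducible transition matrix and unique invariant probability row vector $p$ with positive entries. *)

theory Defs
  imports "HOL-Probability.Probability"
begin

type_synonym path = "real \<Rightarrow> real"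

text \<open>Canonical path space C([0,oo);S). A path is stored as a function on all of
  the reals, normalised by w t = w 0 for t <= 0, so that it is determined by its
  restriction to [0,oo).\<close>
definition Omega :: "real set \<Rightarrow> path set" where
  "Omega S = {w. (\<forall>t. w t \<in> S) \<and> continuous_on UNIV w \<and> (\<forall>t\<le>0. w t = w 0)}"

definition Ft :: "real set \<Rightarrow> real \<Rightarrow> path measure" where
  "Ft S t = sigma (Omega S) {{w \<in> Omega S. w u \<in> B} | u B. 0 \<le> u \<and> u \<le> t \<and> B \<in> sets borel}"

definition FF :: "real set \<Rightarrow> path measure" where
  "FF S = sigma (Omega S) {{w \<in> Omega S. w u \<in> B} | u B. 0 \<le> u \<and> B \<in> sets borel}"

definition stopping_time_can :: "real set \<Rightarrow> (path \<Rightarrow> ereal) \<Rightarrow> bool" where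
  "stopping_time_can S \<tau> \<longleftrightarrow> (\<forall>w\<in>Omega S. 0 \<le> \<tau> w) \<and>
     (\<forall>t\<ge>0. {w \<in> Omega S. \<tau> w \<le> ereal t} \<in> sets (Ft S t))"

definition Ftau :: "real set \<Rightarrow> (path \<Rightarrow> ereal) \<Rightarrow> path measure" where
  "Ftau S \<tau> = measure_of (Omega S)
     {A \<in> sets (FF S). \<forall>t\<ge>0. {w \<in> A. \<tau> w \<le> ereal t} \<in> sets (Ft S t)} (\<lambda>_. 0)"

definition Xat :: "(path \<Rightarrow> ereal) \<Rightarrow> path \<Rightarrow> real" where
  "Xat \<tau> w = w (real_of_ereal (\<tau> w))"

text \<open>Shift sh_tau (w) = w(tau(w) + .); on {tau = oo} it is irrelevant and set to w.\<close>
definition shift :: "(path \<Rightarrow> ereal) \<Rightarrow> path \<Rightarrow> path" where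
  "shift \<tau> w = (if \<tau> w < \<infinity> then (\<lambda>t. w (real_of_ereal (\<tau> w) + max 0 t)) else w)"

text \<open>Successive hitting times tau_1, tau_2, ... of D (index 0 is a dummy).\<close>
fun tau :: "real set \<Rightarrow> nat \<Rightarrow> path \<Rightarrow> ereal" where
  "tau D 0 w = 0"
| "tau D (Suc 0) w = Inf {ereal t | t. 0 \<le> t \<and> w t \<in> D}"
| "tau D (Suc (Suc n)) w =
     Inf {ereal t | t. tau D (Suc n) w \<le> ereal t \<and> w t \<in> D - {Xat (tau D (Suc n)) w}}"

definition strong_markov_family :: "real set \<Rightarrow> (real \<Rightarrow> path measure) \<Rightarrow> bool" where
  "strong_markov_family S P \<longleftrightarrow>
     (\<forall>x\<in>S. prob_space (P x) \<and> sets (P x) = sets (FF S) \<and>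
              emeasure (P x) {w \<in> Omega S. w 0 = x} = 1) \<and>
     (\<forall>A\<in>sets (FF S). (\<lambda>x. emeasure (P x) A) \<in> borel_measurable (restrict_space borel S)) \<and>
     (\<forall>x\<in>S. \<forall>\<tau>. stopping_time_can S \<tau> \<longrightarrow>
        (\<forall>A\<in>sets (Ftau S \<tau>). \<forall>B\<in>sets (FF S).
           emeasure (P x) {w \<in> A. \<tau> w < \<infinity> \<and> shift \<tau> w \<in> B} =
           (\<integral>\<^sup>+ w. indicator {w \<in> A. \<tau> w < \<infinity>} w * emeasure (P (Xat \<tau> w)) B \<partial>P x)))"

definition recurrent :: "real set \<Rightarrow> (real \<Rightarrow> path measure) \<Rightarrow> bool" where
  "recurrent S P \<longleftrightarrow>
     (\<forall>x\<in>S. \<forall>y\<in>S. emeasure (P x) {w \<in> Omega S. \<exists>t\<ge>0. w t = y} = 1)"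

definition chain_trans :: "real set \<Rightarrow> (real \<Rightarrow> path measure) \<Rightarrow> real set \<Rightarrow> real \<Rightarrow> real \<Rightarrow> real" where
  "chain_trans S P D d d' =
     measure (P d) {w \<in> Omega S. tau D 2 w < \<infinity> \<and> Xat (tau D 2) w = d'}"

definition Pmix :: "real set \<Rightarrow> (real \<Rightarrow> path measure) \<Rightarrow> real measure \<Rightarrow> path measure" where
  "Pmix S P \<mu> = measure_of (Omega S) (sets (FF S))
      (\<lambda>A. \<integral>\<^sup>+ x. indicator S x * emeasure (P x) A \<partial>\<mu>)"

definition normal_law :: "real \<Rightarrow> real measure" where
  "normal_law s2 = (if s2 = 0 then return borel 0
                    else density lborel (normal_density 0 (sqrt s2)))"

end

theory Submission
  imports Defs "HOL-Real_Asymp.Real_Asymp"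
begin

text \<open>Let \<open>\<theta>\<close> be the shift by \<open>\<tau>\<^sub>2\<close>. Almost surely \<open>Z\<^sub>k = Z \<circ> \<theta>\<^sup>k\<^sup>-\<^sup>1\<close>, so the strong Markov property at the
  single time \<open>\<tau>\<^sub>2\<close> expresses the characteristic functions of the partial sums under \<open>P\<^sub>d\<close>
  through powers of the matrices \<open>M(s)\<^sub>d\<^sub>e = E\<^sub>d(exp(isZ); X\<^sub>\<tau> = e)\<close>. With \<open>Q\<close> the transition matrix
  and \<open>c\<close> an approximate solution of \<open>(I - Q) c = (\<sigma>\<^sup>2 - E(Z\<^sup>2)) / 2\<close>, the vector \<open>1 + s\<^sup>2 c\<close> is an
  eigenvector of \<open>M(s)\<close> for \<open>exp(- s\<^sup>2 \<sigma>\<^sup>2 / 2)\<close> up to a small multiple of \<open>s\<^sup>2\<close>. As \<open>M(s)\<close> is a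
  contraction, its \<open>n\<close>-th power at \<open>s = t / sqrt n\<close> maps \<open>1\<close> close to \<open>exp(- t\<^sup>2 \<sigma>\<^sup>2 / 2)\<close>, and
  Levy's continuity theorem applies. Recurrence makes \<open>Q\<close> irreducible because a continuous
  path switches only finitely often in bounded time.\<close>

section \<open>Hitting times of a path\<close>

text \<open>Second moments of \<open>Z\<close> are given only under \<open>P d\<close> with
  \<open>d\<close> in \<open>D\<close>; a general starting point offers none. So the first switch is
  split off: it lands in \<open>D\<close> almost surely and contributes a factor whose limit needs
  only the boundedness of \<open>iexp\<close>. This is why the matrix estimates concern n steps at
  scale t / sqrt (n + 1): the first switch supplies the missing summand. The strong Markov property
  is given for events; measurability of \<open>Z\<close> in \<open>Ftau S (tau D 2)\<close> allows
  it to be read as a product-measure identity for the pair (path up to the switch, path after it),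
  and Fubini then produces the matrix recursion. An approximate Poisson solution is enough because a
  defect \<eta> costs about t^2 \<eta> / n per step, hence about t^2 \<eta> in n steps. Averaging
  the iterates of \<open>Q\<close> thus replaces inverting I - Q on the vectors of mean zero, and no
  aperiodicity enters.\<close>

lemma first_hitting_time:
  fixes w :: "real \<Rightarrow> real"
  assumes "continuous_on UNIV w" "closed F" "T \<le> u" "w u \<in> F"
  shows "\<exists>t\<ge>T. w t \<in> F \<and> (\<forall>s\<ge>T. w s \<in> F \<longrightarrow> t \<le> s) \<and>
    Inf {ereal t | t. ereal T \<le> ereal t \<and> w t \<in> F} = ereal t"
proof -
  define A where "A = {T..} \<inter> w -` F"
  have "closed A"
    unfolding A_def using assms(1,2) by (intro closed_Int closed_vimage) auto
  moreover have bdd: "bdd_below A" by (auto simp: A_def bdd_below_def)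
  moreover have uA: "u \<in> A" using assms by (auto simp: A_def)
  \<comment> \<open>A nonempty closed set of reals that is bounded below contains its infimum, so
    the hitting time is attained.\<close>
  ultimately have InA: "Inf A \<in> A" by (intro closed_contains_Inf) auto
  have le: "Inf A \<le> s" if "T \<le> s" "w s \<in> F" for s
    using that bdd by (intro cInf_lower) (auto simp: A_def)
  have "Inf {ereal t | t. ereal T \<le> ereal t \<and> w t \<in> F} = ereal (Inf A)"
    using InA le by (intro Inf_eqI) (auto simp: A_def)
  then show ?thesis
    using InA le by (intro exI[of _ "Inf A"] conjI) (auto simp: A_def)
qed

lemma Omega_continuous_on: "w \<in> Omega S \<Longrightarrow> continuous_on UNIV w"
  by (simp add: Omega_def)

lemma Omega_in_S: "w \<in> Omega S \<Longrightarrow> w t \<in> S"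
  by (simp add: Omega_def)

text \<open>The constraint is written between extended reals so that the set has literally the shape
  in \<open>first_hitting_time\<close> with \<open>T = 0\<close>; \<open>tau_Suc_Suc_finite\<close>
  does the same with \<open>T = t\<close>.\<close>

lemma tau_1: "tau D (Suc 0) w = Inf {ereal t | t. ereal 0 \<le> ereal t \<and> w t \<in> D}"
  by simp

lemma tau_Suc_Suc_finite:
  assumes "tau D (Suc n) w = ereal t"
  shows "tau D (Suc (Suc n)) w = Inf {ereal u | u. ereal t \<le> ereal u \<and> w u \<in> D - {w t}}"
  using assms by (simp add: Xat_def)

lemma tau_Suc_Suc_infinite:
  assumes "tau D (Suc n) w = \<infinity>"
  shows "tau D (Suc (Suc n)) w = \<infinity>"
proof -
  have "{ereal u | u. tau D (Suc n) w \<le> ereal u \<and> w u \<in> D - {Xat (tau D (Suc n)) w}} = {}"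
    using assms by auto
  then show ?thesis by (simp only: tau.simps) (simp add: top_ereal_def)
qed

declare tau.simps(2,3) [simp del]

text \<open>\<open>D\<close> and \<open>D\<close> minus a point are finite, hence closed, so a
  finite hitting time is attained; the value \<infinity> is the infimum of the empty set.\<close>

lemma tau_Suc_cases:
  assumes w: "continuous_on UNIV w" and D: "finite D"
  shows "tau D (Suc n) w = \<infinity> \<or> (\<exists>t\<ge>0. tau D (Suc n) w = ereal t \<and> w t \<in> D)"
proof (induction n)
  case 0
  show ?case
  proof (cases "\<exists>u\<ge>0. w u \<in> D")
    case True
    then obtain u where u: "0 \<le> u" "w u \<in> D" by auto
    obtain t where "0 \<le> t" "w t \<in> D" "Inf {ereal t | t. ereal 0 \<le> ereal t \<and> w t \<in> D} = ereal t"
      using first_hitting_time[OF w finite_imp_closed[OF D] u] by blast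
    then show ?thesis by (intro disjI2 exI[of _ t] conjI) (simp_all only: tau_1)
  next
    case False
    then have "{ereal t | t. ereal 0 \<le> ereal t \<and> w t \<in> D} = {}" by auto
    then show ?thesis by (simp only: tau_1 Inf_empty top_ereal_def simp_thms)
  qed
next
  case (Suc n)
  then consider "tau D (Suc n) w = \<infinity>" | t where "0 \<le> t" "tau D (Suc n) w = ereal t" "w t \<in> D" by auto
  then show ?case
  proof cases
    case 1
    then show ?thesis by (simp add: tau_Suc_Suc_infinite)
  next
    case (2 t)
    note eq = tau_Suc_Suc_finite[OF 2(2)]
    show ?thesis
    proof (cases "\<exists>u\<ge>t. w u \<in> D - {w t}")
      case True
      then obtain u where u: "t \<le> u" "w u \<in> D - {w t}" by auto
      have "closed (D - {w t})" using D by (intro finite_imp_closed) auto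
      then obtain v where
        "t \<le> v" "w v \<in> D - {w t}" "Inf {ereal u | u. ereal t \<le> ereal u \<and> w u \<in> D - {w t}} = ereal v"
        using first_hitting_time[OF w _ u] by blast
      then show ?thesis using 2(1) by (intro disjI2 exI[of _ v] conjI) (auto simp only: eq)
    next
      case False
      then have "{ereal u | u. ereal t \<le> ereal u \<and> w u \<in> D - {w t}} = {}" by auto
      then show ?thesis by (simp only: eq Inf_empty top_ereal_def simp_thms)
    qed
  qed
qed

lemma tau_2_finiteD:
  assumes w: "continuous_on UNIV w" and D: "finite D" and fin: "tau D 2 w < \<infinity>"
  obtains t u where "0 \<le> t" "t \<le> u" "tau D (Suc 0) w = ereal t" "tau D 2 w = ereal u"
    "w t \<in> D" "w u \<in> D" "w u \<noteq> w t" "\<And>s. t \<le> s \<Longrightarrow> w s \<in> D \<Longrightarrow> w s \<noteq> w t \<Longrightarrow> u \<le> s"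
proof -
  have "tau D (Suc 0) w \<noteq> \<infinity>"
    using fin tau_Suc_Suc_infinite[of D 0 w] by (auto simp: numeral_2_eq_2)
  then obtain t where t: "0 \<le> t" "tau D (Suc 0) w = ereal t" "w t \<in> D"
    using tau_Suc_cases[OF w D, of 0] by auto
  note eq = tau_Suc_Suc_finite[OF t(2), folded numeral_2_eq_2]
  have "\<exists>u\<ge>t. w u \<in> D - {w t}"
  proof (rule ccontr)
    assume "\<not> ?thesis"
    then have "{ereal u | u. ereal t \<le> ereal u \<and> w u \<in> D - {w t}} = {}" by auto
    then have "tau D 2 w = \<infinity>" by (simp only: eq Inf_empty top_ereal_def)
    then show False using fin by simp
  qed
  then obtain s where s: "t \<le> s" "w s \<in> D - {w t}" by auto
  have "closed (D - {w t})" using D by (intro finite_imp_closed) auto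
  then obtain u where
    "t \<le> u" "w u \<in> D - {w t}" "\<forall>s\<ge>t. w s \<in> D - {w t} \<longrightarrow> u \<le> s" "tau D 2 w = ereal u"
    unfolding eq using first_hitting_time[OF w _ s] by blast
  with t show ?thesis by (intro that[of t u]) auto
qed

text \<open>The right-hand side mentions neither the first hitting time nor the point excluded
  afterwards. It is a finite combination of events "\<open>d\<close> is hit by time
  \<open>T\<close>", which is what makes \<open>tau D 2\<close> a stopping time.\<close>

lemma tau_2_le_iff:
  assumes w: "continuous_on UNIV w" and D: "finite D"
  shows "tau D 2 w \<le> ereal T \<longleftrightarrow>
    (\<exists>d\<in>D. \<exists>d'\<in>D. d \<noteq> d' \<and> (\<exists>u\<in>{0..T}. w u = d) \<and> (\<exists>u\<in>{0..T}. w u = d'))"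
proof
  assume "tau D 2 w \<le> ereal T"
  moreover from this have "tau D 2 w < \<infinity>" by (cases "tau D 2 w") auto
  ultimately show "(\<exists>d\<in>D. \<exists>d'\<in>D. d \<noteq> d' \<and> (\<exists>u\<in>{0..T}. w u = d) \<and> (\<exists>u\<in>{0..T}. w u = d'))"
    using tau_2_finiteD[OF w D] by (metis atLeastAtMost_iff ereal_less_eq(3) order_trans)
next
  assume "\<exists>d\<in>D. \<exists>d'\<in>D. d \<noteq> d' \<and> (\<exists>u\<in>{0..T}. w u = d) \<and> (\<exists>u\<in>{0..T}. w u = d')"
  then obtain u v where uv: "u \<in> {0..T}" "v \<in> {0..T}" "w u \<in> D" "w v \<in> D" "w u \<noteq> w v" by blast
  have "0 \<le> u" using uv by simp
  then obtain t where
    t: "0 \<le> t" "w t \<in> D" "\<forall>s\<ge>0. w s \<in> D \<longrightarrow> t \<le> s"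
      "Inf {ereal t | t. ereal 0 \<le> ereal t \<and> w t \<in> D} = ereal t"
    using first_hitting_time[OF w finite_imp_closed[OF D] _ uv(3)] by blast
  then have t1: "tau D (Suc 0) w = ereal t" by (simp only: tau_1)
  \<comment> \<open>Both \<open>u\<close> and \<open>v\<close> are at least \<open>t\<close> by
    minimality, and since \<open>w u\<close> and \<open>w v\<close> differ, at least one of them
    differs from \<open>w t\<close>.\<close>
  obtain s where s: "s \<in> {t..T}" "w s \<in> D" "w s \<noteq> w t"
    using uv t by (metis atLeastAtMost_iff)
  have "tau D 2 w = Inf {ereal u | u. ereal t \<le> ereal u \<and> w u \<in> D - {w t}}"
    using tau_Suc_Suc_finite[OF t1] by (simp only: numeral_2_eq_2)
  also have "\<dots> \<le> ereal s" using s by (intro Inf_lower) auto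
  also have "\<dots> \<le> ereal T" using s by simp
  finally show "tau D 2 w \<le> ereal T" .
qed

section \<open>Shifted paths and the composition of shifts\<close>

lemma shift_in_Omega: "w \<in> Omega S \<Longrightarrow> shift \<tau> w \<in> Omega S"
proof -
  assume w: "w \<in> Omega S"
  have "continuous_on UNIV (\<lambda>t. w (real_of_ereal (\<tau> w) + max 0 t))"
    by (rule continuous_on_compose2[OF Omega_continuous_on[OF w]]) (auto intro!: continuous_intros)
  moreover have "w t \<in> S" for t using w by (rule Omega_in_S)
  ultimately have "(\<lambda>t. w (real_of_ereal (\<tau> w) + max 0 t)) \<in> Omega S"
    by (simp add: Omega_def max_absorb1)
  then show ?thesis using w by (simp add: shift_def)
qed

lemma shift_zero: "\<tau> w < \<infinity> \<Longrightarrow> shift \<tau> w 0 = Xat \<tau> w"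
  by (simp add: shift_def Xat_def)

text \<open>The path shifted by a finite hitting time starts in \<open>D\<close>. Its own first
  hitting time is therefore 0, and its second one excludes the same point \<open>w t\<close> as the
  next hitting time of \<open>w\<close>; the two infima range over sets that differ by the
  translation by \<open>t\<close>.\<close>

lemma
  assumes w: "w \<in> Omega S" and D: "finite D" and fin: "tau D (Suc n) w < \<infinity>"
  shows tau_Suc_Suc_shift: "tau D (Suc (Suc n)) w = tau D (Suc n) w + tau D 2 (shift (tau D (Suc n)) w)"
    and shift_tau_Suc_Suc: "tau D (Suc (Suc n)) w < \<infinity> \<Longrightarrow>
      shift (tau D (Suc (Suc n))) w = shift (tau D 2) (shift (tau D (Suc n)) w)"
proof -
  have cw: "continuous_on UNIV w" by (rule Omega_continuous_on) fact
  obtain t where t: "t \<ge> 0" "tau D (Suc n) w = ereal t" "w t \<in> D"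
    using tau_Suc_cases[OF cw D, of n] fin by auto
  define w' where "w' = shift (tau D (Suc n)) w"
  have w': "w' u = w (t + max 0 u)" for u
    using t by (simp add: w'_def shift_def)
  have t1: "tau D (Suc 0) w' = ereal 0"
    unfolding tau_1 using t by (intro Inf_eqI) (auto simp: w')
  have eq1: "tau D 2 w' = Inf {ereal u | u. ereal 0 \<le> ereal u \<and> w' u \<in> D - {w t}}" (is "_ = Inf ?A")
    using tau_Suc_Suc_finite[OF t1] t(1) by (simp only: numeral_2_eq_2 w' max.idem add_0_right)
  note eq2 = tau_Suc_Suc_finite[OF t(2)]
  have A: "{ereal u | u. ereal t \<le> ereal u \<and> w u \<in> D - {w t}} = (\<lambda>x. ereal t + x) ` ?A"
  proof (intro equalityI subsetI)
    fix x assume "x \<in> {ereal u | u. ereal t \<le> ereal u \<and> w u \<in> D - {w t}}"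
    then obtain u where "x = ereal u" "t \<le> u" "w u \<in> D - {w t}" by auto
    then show "x \<in> (\<lambda>x. ereal t + x) ` ?A"
      by (intro image_eqI[of _ _ "ereal (u - t)"]) (auto simp: w')
  next
    fix x assume "x \<in> (\<lambda>x. ereal t + x) ` ?A"
    then obtain u where "x = ereal t + ereal u" "0 \<le> u" "w' u \<in> D - {w t}" by auto
    then show "x \<in> {ereal u | u. ereal t \<le> ereal u \<and> w u \<in> D - {w t}}"
      by (auto intro!: exI[of _ "t + u"] simp: w')
  qed
  \<comment> \<open>When no further switch occurs, both sides are the infimum of the empty set,
    \<infinity>.\<close>
  have "Inf ((\<lambda>x. ereal t + x) ` ?A) = ereal t + Inf ?A"
  proof (cases "?A = {}")
    case True
    then show ?thesis by (simp only: True Inf_empty image_empty top_ereal_def) simp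
  next
    case False
    have "(INF x\<in>?A. ereal t + x) = ereal t + (INF x\<in>?A. x)"
      by (rule INF_ereal_add_right[OF False]) auto
    then show ?thesis by simp
  qed
  then show eq: "tau D (Suc (Suc n)) w = tau D (Suc n) w + tau D 2 (shift (tau D (Suc n)) w)"
    unfolding eq2 A by (simp only: t(2) eq1 flip: w'_def)
  assume fin2: "tau D (Suc (Suc n)) w < \<infinity>"
  then have "ereal t + tau D 2 w' < \<infinity>" by (simp only: eq t(2) flip: w'_def)
  then have "tau D 2 w' < \<infinity>" by (cases "tau D 2 w'") simp_all
  moreover have "continuous_on UNIV w'"
    unfolding w'_def by (intro Omega_continuous_on[of _ S] shift_in_Omega w)
  ultimately obtain s u where "0 \<le> s" "s \<le> u" and u: "tau D 2 w' = ereal u"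
    using D by (elim tau_2_finiteD)
  have "tau D (Suc (Suc n)) w = ereal (t + u)" by (simp only: eq t(2) u plus_ereal.simps flip: w'_def)
  then have "shift (tau D (Suc (Suc n))) w = (\<lambda>s. w (t + u + max 0 s))" unfolding shift_def by simp
  also have "\<dots> = shift (tau D 2) w'" using \<open>0 \<le> s\<close> \<open>s \<le> u\<close>
    by (intro ext) (simp add: shift_def u w' add.assoc max_absorb2)
  finally show "shift (tau D (Suc (Suc n))) w = shift (tau D 2) (shift (tau D (Suc n)) w)"
    unfolding w'_def .
qed

lemma Omega_max_0:
  assumes "w \<in> Omega S"
  shows "w (max 0 t) = w t"
proof (cases "t \<le> 0")
  case True
  then have "w t = w 0" using assms unfolding Omega_def by blast
  then show ?thesis using True by (simp only: max_absorb1)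
qed simp

lemma tau_1_zero:
  assumes "w 0 \<in> D"
  shows "tau D (Suc 0) w = ereal 0"
  unfolding tau_1 using assms by (intro Inf_eqI) auto

text \<open>If some visit to \<open>D\<close> were missed, all switching times would lie before it
  and would accumulate at a finite time \<open>L\<close>. By continuity the positions at successive
  switches would become arbitrarily close, yet they are distinct points of a finite set.\<close>

lemma continuous_path_iterates_visit:
  assumes D: "finite D" and w: "w \<in> Omega S" and w0: "w 0 \<in> D"
    and fin: "\<And>k. tau D 2 ((shift (tau D 2) ^^ k) w) < \<infinity>"
    and t: "0 \<le> t" "w t \<in> D"
  shows "\<exists>k. (shift (tau D 2) ^^ k) w 0 = w t"
proof (rule ccontr)
  assume never: "\<not> ?thesis"
  define v where "v k = (shift (tau D 2) ^^ k) w" for k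
  \<comment> \<open>The time of the \<open>k\<close>-th switch on the clock of the original path, as
    a sum of waiting times.\<close>
  define T where "T k = (\<Sum>j<k. real_of_ereal (tau D 2 (v j)))" for k
  have v\<Omega>: "v k \<in> Omega S" for k
    unfolding v_def by (induction k) (simp_all add: w shift_in_Omega)
  have v_Suc: "v (Suc k) = shift (tau D 2) (v k)" for k
    by (simp add: v_def)
  have v_shift: "v (Suc k) s = v k (real_of_ereal (tau D 2 (v k)) + max 0 s)" for k s
    using fin[of k, folded v_def] unfolding v_Suc shift_def by simp
  have step: "\<exists>u\<ge>0. tau D 2 (v k) = ereal u \<and> v k u \<in> D \<and> v k u \<noteq> v k 0 \<and>
      (\<forall>s\<ge>0. v k s \<in> D \<longrightarrow> v k s \<noteq> v k 0 \<longrightarrow> u \<le> s)" if "v k 0 \<in> D" for k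
  proof (rule tau_2_finiteD[OF Omega_continuous_on[OF v\<Omega>] D fin[of k, folded v_def]])
    fix r u assume *: "0 \<le> r" "r \<le> u" "tau D (Suc 0) (v k) = ereal r" "tau D 2 (v k) = ereal u"
      "v k u \<in> D" "v k u \<noteq> v k r" "\<And>s. r \<le> s \<Longrightarrow> v k s \<in> D \<Longrightarrow> v k s \<noteq> v k r \<Longrightarrow> u \<le> s"
    moreover have "r = 0" using *(3) tau_1_zero[of "v k" D] that by simp
    ultimately show ?thesis by blast
  qed
  have vD: "v k 0 \<in> D" for k
  proof (induction k)
    case 0 then show ?case using w0 by (simp add: v_def)
  next
    case (Suc k) then show ?case using step[of k] by (auto simp: v_shift)
  qed
  have T_Suc: "T (Suc k) = T k + real_of_ereal (tau D 2 (v k))" for k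
    by (simp add: T_def)
  have v_eq: "v k s = w (T k + max 0 s)" for k s
  proof (induction k arbitrary: s)
    case 0
    show ?case using Omega_max_0[OF w, of s] by (simp add: v_def T_def)
  next
    case (Suc k)
    obtain u where u: "u \<ge> 0" "tau D 2 (v k) = ereal u" using step[OF vD] by blast
    then show ?case by (simp add: v_shift Suc.IH T_Suc add.assoc max_absorb2)
  qed
  have vT: "w (T k) = v k 0" for k by (simp add: v_eq)
  have T_le: "T k \<le> t" for k
  proof (induction k)
    case 0 then show ?case using t by (simp add: T_def)
  next
    case (Suc k)
    obtain u where u: "tau D 2 (v k) = ereal u"
        "\<forall>s\<ge>0. v k s \<in> D \<longrightarrow> v k s \<noteq> v k 0 \<longrightarrow> u \<le> s"
      using step[OF vD] by blast
    have "v k (t - T k) = w t" using Suc by (simp add: v_eq max_absorb2)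
    moreover have "w t \<noteq> v k 0" using never v_def by metis
    \<comment> \<open>The path \<open>v k\<close> sees the missed point at time
      \<open>t - T k\<close>. By \<open>never\<close> that point is not where \<open>v k\<close>
      starts, so the next switch comes no later.\<close>
    ultimately have "u \<le> t - T k" using u(2) t(2) Suc by simp
    then show ?case using u by (simp add: T_Suc)
  qed
  have "incseq T"
  proof (rule incseq_SucI)
    fix k
    obtain u where "0 \<le> u" "tau D 2 (v k) = ereal u" using step[OF vD] by blast
    then show "T k \<le> T (Suc k)" by (simp add: T_Suc)
  qed
  then obtain L where L: "T \<longlonglongrightarrow> L" using incseq_convergent[of T t] T_le by blast
  have "continuous_on UNIV w" by (rule Omega_continuous_on) fact
  then have "isCont w L" by (simp add: continuous_on_eq_continuous_at)
  then have wT: "(\<lambda>k. w (T k)) \<longlonglongrightarrow> w L" using L by (rule isCont_tendsto_compose)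
  then have "(\<lambda>k. w (T (Suc k)) - w (T k)) \<longlonglongrightarrow> w L - w L"
    by (intro tendsto_diff LIMSEQ_Suc)
  \<comment> \<open>The differences of distinct points of \<open>D\<close> form a finite, hence
    closed, set without 0, but the increments \<open>w (T (Suc k)) - w (T k)\<close> lie in it and
    tend to 0.\<close>
  moreover have "closed ((\<lambda>(a, b). a - b) ` (D \<times> D - Id))" (is "closed ?G")
    using D by (intro finite_imp_closed) auto
  moreover have "w (T (Suc k)) - w (T k) \<in> ?G" for k
  proof -
    have "v (Suc k) 0 \<noteq> v k 0" using step[OF vD, of k] by (auto simp: v_shift)
    then show ?thesis using vD by (auto simp: vT)
  qed
  ultimately have "w L - w L \<in> ?G" by (rule closed_sequentially[rotated 2])
  then show False by auto
qed

section \<open>Measurability on the canonical space\<close>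

lemma space_FF: "space (FF S) = Omega S"
  unfolding FF_def by (rule space_measure_of) auto

lemma space_Ft: "space (Ft S t) = Omega S"
  unfolding Ft_def by (rule space_measure_of) auto

lemma sets_Ft_subset: "sets (Ft S t) \<subseteq> sets (FF S)"
  unfolding Ft_def FF_def
  by (subst (1 2) sets_measure_of, blast, blast) (rule sigma_sets_mono', blast)

lemma space_Ftau: "space (Ftau S \<tau>) = Omega S"
  unfolding Ftau_def by (rule space_measure_of) (use sets.sets_into_space space_FF in blast)

text \<open>\<open>Ftau\<close> is the sigma-algebra generated by the family in its definition, so
  it suffices that this family lies in \<open>FF\<close>; its closure properties do not have to be
  checked.\<close>

lemma sets_Ftau_subset: "sets (Ftau S \<tau>) \<subseteq> sets (FF S)"
proof -
  have "{A \<in> sets (FF S). \<forall>t\<ge>0. {w \<in> A. \<tau> w \<le> ereal t} \<in> sets (Ft S t)} \<subseteq> Pow (Omega S)"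
    using sets.sets_into_space space_FF by blast
  then have "sets (Ftau S \<tau>) = sigma_sets (space (FF S))
      {A \<in> sets (FF S). \<forall>t\<ge>0. {w \<in> A. \<tau> w \<le> ereal t} \<in> sets (Ft S t)}"
    unfolding Ftau_def space_FF by (rule sets_measure_of)
  also have "\<dots> \<subseteq> sets (FF S)" by (rule sets.sigma_sets_subset) auto
  finally show ?thesis .
qed

lemma measurable_Ftau_imp_FF: "f \<in> measurable (Ftau S \<tau>) N \<Longrightarrow> f \<in> measurable (FF S) N"
  using sets_Ftau_subset by (fastforce simp: measurable_def space_Ftau space_FF)

lemma measurable_coordinate_Ft:
  assumes "0 \<le> u" "u \<le> t"
  shows "(\<lambda>w. w u) \<in> borel_measurable (Ft S t)"
proof (rule measurableI)
  fix B :: "real set" assume B: "B \<in> sets borel"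
  have "(\<lambda>w. w u) -` B \<inter> space (Ft S t) = {w \<in> Omega S. w u \<in> B}" by (auto simp: space_Ft)
  also have "\<dots> \<in> sets (Ft S t)"
    unfolding Ft_def using assms B by (intro in_measure_of) auto
  finally show "(\<lambda>w. w u) -` B \<inter> space (Ft S t) \<in> sets (Ft S t)" .
qed auto

lemma measurable_coordinate [measurable]: "(\<lambda>w. w u) \<in> borel_measurable (FF S)"
proof -
  have *: "(\<lambda>w. w u) \<in> borel_measurable (FF S)" if "0 \<le> u" for u
    using measurable_coordinate_Ft[OF that order_refl] sets_Ft_subset
    by (fastforce simp: measurable_def space_Ft space_FF)
  \<comment> \<open>Generators of \<open>FF\<close> involve nonnegative times only; at negative
    times the normalisation of paths gives the value at 0.\<close>
  have "(\<lambda>w. w (max 0 u)) \<in> borel_measurable (FF S)" by (rule *) simp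
  also have "?this \<longleftrightarrow> (\<lambda>w. w u) \<in> borel_measurable (FF S)"
    by (intro measurable_cong) (simp add: space_FF Omega_max_0)
  finally show ?thesis .
qed

text \<open>The uncountable union over times becomes a countable condition: the distance to
  \<open>d\<close> gets arbitrarily small along times \<open>min \<bar>q\<bar> T\<close> with
  \<open>q\<close> rational, all of which lie in \<open>{0..T}\<close>. By compactness the minimal
  distance is attained, so it is 0 at some time.\<close>

lemma sets_hit_before:
  assumes T: "0 \<le> T"
  shows "{w \<in> Omega S. \<exists>u\<in>{0..T}. w u = d} \<in> sets (Ft S T)"
proof -
  have [measurable]: "(\<lambda>w. w (min \<bar>real_of_rat q\<bar> T)) \<in> borel_measurable (Ft S T)" for q
    using T by (intro measurable_coordinate_Ft) auto
  have "(\<exists>u\<in>{0..T}. w u = d) \<longleftrightarrow> (\<forall>n::nat. \<exists>q. \<bar>w (min \<bar>real_of_rat q\<bar> T) - d\<bar> < 1 / real (Suc n))"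
    (is "?L \<longleftrightarrow> ?R") if w: "w \<in> Omega S" for w
  proof
    assume ?L
    then obtain u where u: "0 \<le> u" "u \<le> T" "w u = d" by auto
    show ?R
    proof
      fix n :: nat
      have "isCont w u"
        using Omega_continuous_on[OF w] by (simp add: continuous_on_eq_continuous_at)
      then obtain e where e: "e > 0" "\<And>s. dist s u < e \<Longrightarrow> dist (w s) (w u) < 1 / real (Suc n)"
        unfolding continuous_at_eps_delta by (metis of_nat_0_less_iff zero_less_Suc zero_less_divide_1_iff)
      \<comment> \<open>A rational just to the right of \<open>u\<close>; truncation at
        \<open>T\<close> can only bring it closer, as \<open>u \<le> T\<close>.\<close>
      obtain q where q: "u < real_of_rat q" "real_of_rat q < u + e"
        using of_rat_dense[of u "u + e"] e(1) by auto
      have "\<bar>real_of_rat q\<bar> = real_of_rat q" using q(1) u(1) by linarith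
      then have "dist (min \<bar>real_of_rat q\<bar> T) u < e"
        using q u e(1) by (simp only:) (auto simp: dist_real_def min_def)
      from e(2)[OF this] show "\<exists>q. \<bar>w (min \<bar>real_of_rat q\<bar> T) - d\<bar> < 1 / real (Suc n)"
        using u by (auto simp: dist_real_def)
    qed
  next
    assume R: ?R
    have "continuous_on {0..T} (\<lambda>u. \<bar>w u - d\<bar>)"
      using Omega_continuous_on[OF w] by (intro continuous_intros) (auto intro: continuous_on_subset)
    then obtain u where u: "u \<in> {0..T}" "\<And>s. s \<in> {0..T} \<Longrightarrow> \<bar>w u - d\<bar> \<le> \<bar>w s - d\<bar>"
      using continuous_attains_inf[of "{0..T}" "\<lambda>u. \<bar>w u - d\<bar>"] T by auto
    have le: "\<bar>w u - d\<bar> \<le> 1 / real (Suc n)" for n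
    proof -
      obtain q where "\<bar>w (min \<bar>real_of_rat q\<bar> T) - d\<bar> < 1 / real (Suc n)" using R by blast
      moreover have "\<bar>w u - d\<bar> \<le> \<bar>w (min \<bar>real_of_rat q\<bar> T) - d\<bar>" using T by (intro u(2)) auto
      ultimately show ?thesis by linarith
    qed
    have "\<bar>w u - d\<bar> \<le> 0"
      using le by (intro LIMSEQ_le_const[OF LIMSEQ_inverse_real_of_nat]) (auto simp: inverse_eq_divide)
    then show ?L using u(1) by auto
  qed
  then have "{w \<in> Omega S. \<exists>u\<in>{0..T}. w u = d} =
    {w \<in> space (Ft S T). \<forall>n::nat. \<exists>q. \<bar>w (min \<bar>real_of_rat q\<bar> T) - d\<bar> < 1 / real (Suc n)}"
    by (auto simp: space_Ft)
  also have "\<dots> \<in> sets (Ft S T)" by measurable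
  finally show ?thesis .
qed

lemma stopping_time_tau_2:
  assumes D: "finite D"
  shows "stopping_time_can S (tau D 2)"
  unfolding stopping_time_can_def
proof (intro conjI ballI allI impI)
  fix w assume "w \<in> Omega S"
  then show "0 \<le> tau D 2 w"
    using tau_Suc_cases[OF Omega_continuous_on D, of w S 1] by (auto simp: numeral_2_eq_2)
next
  fix t :: real assume t: "0 \<le> t"
  define H where "H d = {w \<in> Omega S. \<exists>u\<in>{0..t}. w u = d}" for d
  have "{w \<in> Omega S. tau D 2 w \<le> ereal t} = (\<Union>d\<in>D. \<Union>d'\<in>D - {d}. H d \<inter> H d')"
  proof (rule set_eqI)
    fix w
    show "w \<in> {w \<in> Omega S. tau D 2 w \<le> ereal t} \<longleftrightarrow> w \<in> (\<Union>d\<in>D. \<Union>d'\<in>D - {d}. H d \<inter> H d')"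
    proof (cases "w \<in> Omega S")
      case True
      then have "w \<in> H d \<longleftrightarrow> (\<exists>u\<in>{0..t}. w u = d)" for d by (simp add: H_def)
      then show ?thesis
        using True tau_2_le_iff[OF Omega_continuous_on[OF True] D, of t] by (simp del: atLeastAtMost_iff) blast
    qed (simp add: H_def)
  qed
  also have "\<dots> \<in> sets (Ft S t)"
    using D sets_hit_before[OF t, of S] by (intro sets.finite_UN sets.Int) (auto simp: H_def)
  finally show "{w \<in> Omega S. tau D 2 w \<le> ereal t} \<in> sets (Ft S t)" .
qed

lemma measurable_tau_2 [measurable]:
  assumes D: "finite D"
  shows "tau D 2 \<in> borel_measurable (FF S)"
proof (subst borel_measurable_iff_Iic_ereal, intro allI)
  fix a :: ereal
  have nonneg: "0 \<le> tau D 2 w" if "w \<in> Omega S" for w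
    using stopping_time_tau_2[OF D, of S] that unfolding stopping_time_can_def by blast
  have "{w \<in> Omega S. tau D 2 w \<le> a} \<in> sets (FF S)"
  proof (cases a)
    case (real r)
    show ?thesis
    proof (cases "0 \<le> r")
      case True
      then have "{w \<in> Omega S. tau D 2 w \<le> a} \<in> sets (Ft S r)"
        using stopping_time_tau_2[OF D, of S] unfolding stopping_time_can_def real by blast
      then show ?thesis using sets_Ft_subset by blast
    next
      case False
      then have "\<not> tau D 2 w \<le> a" if "w \<in> Omega S" for w
        using nonneg[OF that] real by (cases "tau D 2 w") auto
      then have "{w \<in> Omega S. tau D 2 w \<le> a} = {}" by blast
      then show ?thesis by (simp only: sets.empty_sets)
    qed
  next
    case PInf
    then show ?thesis using sets.top[of "FF S"] by (simp add: space_FF)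
  next
    case MInf
    then have "\<not> tau D 2 w \<le> a" if "w \<in> Omega S" for w
      using nonneg[OF that] by auto
    then have "{w \<in> Omega S. tau D 2 w \<le> a} = {}" by blast
    then show ?thesis by (simp only: sets.empty_sets)
  qed
  moreover have "tau D 2 -` {..a} \<inter> space (FF S) = {w \<in> Omega S. tau D 2 w \<le> a}" by (auto simp: space_FF)
  ultimately show "tau D 2 -` {..a} \<inter> space (FF S) \<in> sets (FF S)" by simp
qed

text \<open>Rounding \<open>r\<close> down to multiples of 1/(n+1) leaves countably many evaluation
  times, each with a measurable coordinate; continuity of the path recovers the value at
  \<open>r w\<close> in the limit.\<close>

lemma measurable_eval_random_time:
  assumes r [measurable]: "r \<in> borel_measurable (FF S)"
  shows "(\<lambda>w. w (r w)) \<in> borel_measurable (FF S)"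
proof (rule borel_measurable_LIMSEQ_real)
  define r' where "r' n w = real_of_int \<lfloor>real (Suc n) * r w\<rfloor> / real (Suc n)" for n w
  show "(\<lambda>w. w (r' n w)) \<in> borel_measurable (FF S)" for n
    unfolding r'_def
    by (rule measurable_compose_countable[where f = "\<lambda>i w. w (real_of_int i / real (Suc n))"]) measurable
  fix w assume "w \<in> space (FF S)"
  then have "isCont w (r w)"
    using Omega_continuous_on[of w S] by (simp add: space_FF continuous_on_eq_continuous_at)
  moreover have "(\<lambda>n. r' n w) \<longlonglongrightarrow> r w"
  proof (rule LIM_zero_cancel, rule Lim_null_comparison[OF _ LIMSEQ_inverse_real_of_nat])
    show "\<forall>\<^sub>F n in sequentially. norm (r' n w - r w) \<le> inverse (real (Suc n))"
    proof (intro always_eventually allI)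
      fix n
      have "r' n w - r w = (real_of_int \<lfloor>real (Suc n) * r w\<rfloor> - real (Suc n) * r w) / real (Suc n)"
        by (simp add: r'_def diff_divide_distrib)
      moreover have "\<bar>real_of_int \<lfloor>real (Suc n) * r w\<rfloor> - real (Suc n) * r w\<bar> \<le> 1"
        by linarith
      ultimately show "norm (r' n w - r w) \<le> inverse (real (Suc n))"
        by (simp add: divide_right_mono inverse_eq_divide del: of_nat_Suc)
    qed
  qed
  ultimately show "(\<lambda>n. w (r' n w)) \<longlonglongrightarrow> w (r w)" by (rule isCont_tendsto_compose)
qed

lemma measurable_Xat_tau_2 [measurable]: "finite D \<Longrightarrow> Xat (tau D 2) \<in> borel_measurable (FF S)"
  unfolding Xat_def by (rule measurable_eval_random_time) measurable

lemma measurable_FF_I: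
  assumes "\<And>w. w \<in> space M \<Longrightarrow> f w \<in> Omega S" "\<And>u. (\<lambda>w. f w u) \<in> borel_measurable M"
  shows "f \<in> measurable M (FF S)"
  unfolding FF_def
proof (rule measurable_measure_of)
  fix A assume "A \<in> {{w \<in> Omega S. w u \<in> B} |u B. 0 \<le> u \<and> B \<in> sets borel}"
  then obtain u B where A: "A = {w \<in> Omega S. w u \<in> B}" "B \<in> sets borel" by auto
  have "f -` A \<inter> space M = (\<lambda>w. f w u) -` B \<inter> space M" using assms(1) A by auto
  then show "f -` A \<inter> space M \<in> sets M" using measurable_sets[OF assms(2)] A by simp
qed (use assms in auto)

lemma measurable_shift_tau_2 [measurable]:
  assumes [simp]: "finite D"
  shows "shift (tau D 2) \<in> measurable (FF S) (FF S)"
proof (rule measurable_FF_I)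
  fix u
  have [measurable]: "(\<lambda>w. w (real_of_ereal (tau D 2 w) + max 0 u)) \<in> borel_measurable (FF S)"
    by (rule measurable_eval_random_time) measurable
  have "(\<lambda>w. shift (tau D 2) w u) =
      (\<lambda>w. if tau D 2 w < \<infinity> then w (real_of_ereal (tau D 2 w) + max 0 u) else w u)"
    by (auto simp: shift_def)
  also have "\<dots> \<in> borel_measurable (FF S)" by measurable
  finally show "(\<lambda>w. shift (tau D 2) w u) \<in> borel_measurable (FF S)" .
qed (simp add: space_FF shift_in_Omega)

section \<open>The chain of switches\<close>

locale recurrent_diffusion =
  fixes S D :: "real set" and P :: "real \<Rightarrow> path measure"
  assumes S_borel: "S \<in> sets borel"
    and finite_D [simp]: "finite D" and D_subset: "D \<subseteq> S" and card_D: "card D \<ge> 2"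
    and markov: "strong_markov_family S P"
    and rec: "recurrent S P"
begin

abbreviation \<tau> :: "path \<Rightarrow> ereal" where "\<tau> \<equiv> tau D 2"
abbreviation \<theta> :: "path \<Rightarrow> path" where "\<theta> \<equiv> shift (tau D 2)"
abbreviation Q :: "real \<Rightarrow> real \<Rightarrow> real" where "Q \<equiv> chain_trans S P D"

lemmas measurable_tau [measurable] = measurable_tau_2[OF finite_D, of S]
lemmas measurable_Xat [measurable] = measurable_Xat_tau_2[OF finite_D, of S]
lemmas measurable_shift [measurable] = measurable_shift_tau_2[OF finite_D, of S]

lemma prob_space_P: "x \<in> S \<Longrightarrow> prob_space (P x)"
  and sets_P [measurable_cong]: "x \<in> S \<Longrightarrow> sets (P x) = sets (FF S)"
  using markov by (auto simp: strong_markov_family_def)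

lemma space_P: "x \<in> S \<Longrightarrow> space (P x) = Omega S"
  using sets_eq_imp_space_eq[OF sets_P] by (simp add: space_FF)

lemma AE_P_I:
  assumes "x \<in> S" "emeasure (P x) {w \<in> Omega S. R w} = 1"
  shows "AE w in P x. R w"
proof -
  interpret prob_space "P x" by (rule prob_space_P) fact
  have "prob {w \<in> Omega S. R w} = 1" using assms by (simp add: measure_def)
  from AE_prob_1[OF this] show ?thesis by auto
qed

lemma AE_start: "x \<in> S \<Longrightarrow> AE w in P x. w 0 = x"
  using markov by (intro AE_P_I) (auto simp: strong_markov_family_def)

lemma AE_visits: "x \<in> S \<Longrightarrow> y \<in> S \<Longrightarrow> AE w in P x. \<exists>t\<ge>0. w t = y"
  using rec by (intro AE_P_I) (auto simp: recurrent_def)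

text \<open>\<open>D\<close> has two distinct points and recurrence makes the path visit both; the
  later of the two visits bounds \<open>tau D 2\<close>.\<close>

lemma AE_tau_finite:
  assumes x: "x \<in> S"
  shows "AE w in P x. \<tau> w < \<infinity>"
proof -
  obtain a b where ab: "a \<in> D" "b \<in> D" "a \<noteq> b"
    using card_D card_le_Suc0_iff_eq[OF finite_D] by (auto simp: not_le[symmetric])
  then have "a \<in> S" "b \<in> S" using D_subset by auto
  from AE_visits[OF x this(1)] AE_visits[OF x this(2)] AE_space show ?thesis
  proof eventually_elim
    case (elim w)
    then obtain t u where tu: "t \<ge> 0" "w t = a" "u \<ge> 0" "w u = b" by auto
    have "continuous_on UNIV w" using elim by (simp add: space_P[OF x] Omega_continuous_on)
    define r where "r = max t u"
    have "\<tau> w \<le> ereal r"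
      unfolding tau_2_le_iff[OF \<open>continuous_on UNIV w\<close> finite_D] using ab tu
      by (intro bexI[of _ a] bexI[of _ b] conjI bexI[of _ t] bexI[of _ u]) (auto simp: r_def)
    then show ?case by auto
  qed
qed

lemma Xat_tau_in_D:
  assumes "w \<in> Omega S" "\<tau> w < \<infinity>"
  shows "Xat \<tau> w \<in> D"
proof (rule tau_2_finiteD[OF Omega_continuous_on[OF assms(1)] finite_D assms(2)])
  fix t u assume "\<tau> w = ereal u" "w u \<in> D"
  then show ?thesis by (simp add: Xat_def)
qed

lemma AE_Xat_D:
  assumes x: "x \<in> S"
  shows "AE w in P x. Xat \<tau> w \<in> D"
  using AE_tau_finite[OF x] AE_space by eventually_elim (simp add: Xat_tau_in_D space_P[OF x])

lemma markov_property:
  assumes "x \<in> S" "A \<in> sets (Ftau S \<tau>)" "B \<in> sets (FF S)"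
  shows "emeasure (P x) {w \<in> A. \<tau> w < \<infinity> \<and> \<theta> w \<in> B} =
    (\<integral>\<^sup>+ w. indicator {w \<in> A. \<tau> w < \<infinity>} w * emeasure (P (Xat \<tau> w)) B \<partial>P x)"
  using markov stopping_time_tau_2[OF finite_D, of S] assms
  unfolding strong_markov_family_def by blast

text \<open>Fixing the landing point turns the random factor
  \<open>emeasure (P (Xat \<tau> w)) B\<close> into a constant, so that the strong Markov property
  becomes a product formula.\<close>

lemma markov_property_at:
  assumes x: "x \<in> S" and A: "A \<in> sets (Ftau S \<tau>)" and B: "B \<in> sets (FF S)" and d: "d \<in> D"
  shows "emeasure (P x) {w \<in> A. \<tau> w < \<infinity> \<and> Xat \<tau> w = d \<and> \<theta> w \<in> B} =
    emeasure (P x) {w \<in> A. \<tau> w < \<infinity> \<and> Xat \<tau> w = d} * emeasure (P d) B"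
proof -
  have A': "A \<in> sets (FF S)" using A sets_Ftau_subset by blast
  have A\<Omega>: "A \<subseteq> Omega S" using sets.sets_into_space[OF A'] by (simp add: space_FF)
  \<comment> \<open>The landing point is the start of the shifted path, so the condition on it can
    be moved into the future event. Under \<open>P y\<close> this event is null unless
    \<open>y = d\<close>.\<close>
  define B' where "B' = {w \<in> B. w 0 = d}"
  have B': "B' \<in> sets (FF S)"
  proof -
    have "B' = B \<inter> {w \<in> space (FF S). w 0 = d}"
      using sets.sets_into_space[OF B] by (auto simp: B'_def)
    also have "\<dots> \<in> sets (FF S)" using B by measurable
    finally show ?thesis .
  qed
  have E: "{w \<in> A. \<tau> w < \<infinity> \<and> Xat \<tau> w = d} \<in> sets (P x)"
  proof -
    have "{w \<in> A. \<tau> w < \<infinity> \<and> Xat \<tau> w = d} = A \<inter> {w \<in> space (FF S). \<tau> w < \<infinity> \<and> Xat \<tau> w = d}"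
      using A\<Omega> by (auto simp: space_FF)
    also have "\<dots> \<in> sets (FF S)" using A' by measurable
    finally show ?thesis using sets_P[OF x] by simp
  qed
  have PB': "emeasure (P y) B' = (if y = d then emeasure (P d) B else 0)" if y: "y \<in> S" for y
  proof (cases "y = d")
    case True
    have "emeasure (P y) B' = emeasure (P y) B"
      using AE_start[OF y] B B' sets_P[OF y] True by (intro emeasure_eq_AE) (auto simp: B'_def)
    then show ?thesis using True by simp
  next
    case False
    have "emeasure (P y) B' = emeasure (P y) {}"
      using AE_start[OF y] B' sets_P[OF y] False by (intro emeasure_eq_AE) (auto simp: B'_def)
    then show ?thesis using False by simp
  qed
  have "{w \<in> A. \<tau> w < \<infinity> \<and> Xat \<tau> w = d \<and> \<theta> w \<in> B} = {w \<in> A. \<tau> w < \<infinity> \<and> \<theta> w \<in> B'}"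
    by (auto simp: B'_def shift_zero)
  also have "emeasure (P x) \<dots> = (\<integral>\<^sup>+ w. indicator {w \<in> A. \<tau> w < \<infinity>} w * emeasure (P (Xat \<tau> w)) B' \<partial>P x)"
    by (rule markov_property[OF x A B'])
  also have "\<dots> = (\<integral>\<^sup>+ w. emeasure (P d) B * indicator {w \<in> A. \<tau> w < \<infinity> \<and> Xat \<tau> w = d} w \<partial>P x)"
  proof (rule nn_integral_cong_AE)
    show "AE w in P x. indicator {w \<in> A. \<tau> w < \<infinity>} w * emeasure (P (Xat \<tau> w)) B' =
        emeasure (P d) B * indicator {w \<in> A. \<tau> w < \<infinity> \<and> Xat \<tau> w = d} w"
      using AE_Xat_D[OF x]
    proof eventually_elim
      case (elim w)
      then have "Xat \<tau> w \<in> S" using D_subset by auto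
      then show ?case by (auto simp: PB' indicator_def)
    qed
  qed
  also have "\<dots> = emeasure (P d) B * emeasure (P x) {w \<in> A. \<tau> w < \<infinity> \<and> Xat \<tau> w = d}"
    by (rule nn_integral_cmult_indicator[OF E])
  finally show ?thesis by (simp add: mult.commute)
qed

text \<open>The exceptional set of \<open>R\<close> is null from every landing point in
  \<open>C\<close>, and the strong Markov property pulls this back across one switch. A general
  \<open>C\<close> instead of \<open>D\<close> is what the irreducibility argument uses.\<close>

lemma AE_shift:
  assumes x: "x \<in> S" and R: "{w \<in> Omega S. R w} \<in> sets (FF S)"
    and C: "C \<subseteq> D" "AE w in P x. Xat \<tau> w \<in> C" "\<And>d. d \<in> C \<Longrightarrow> AE w in P d. R w"
  shows "AE w in P x. R (\<theta> w)"
proof -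
  define B where "B = Omega S - {w \<in> Omega S. R w}"
  have B: "B \<in> sets (FF S)"
    unfolding B_def using R sets.top[of "FF S"] by (auto simp: space_FF)
  have top: "Omega S \<in> sets (Ftau S \<tau>)" using sets.top[of "Ftau S \<tau>"] by (simp add: space_Ftau)
  have PB: "emeasure (P d) B = 0" if d: "d \<in> C" for d
  proof -
    have dS: "d \<in> S" using d C D_subset by auto
    have "emeasure (P d) B = emeasure (P d) {}"
      using C(3)[OF d] B sets_P[OF dS] by (intro emeasure_eq_AE) (auto simp: B_def)
    then show ?thesis by simp
  qed
  have "emeasure (P x) {w \<in> Omega S. \<tau> w < \<infinity> \<and> \<theta> w \<in> B} =
    (\<integral>\<^sup>+ w. indicator {w \<in> Omega S. \<tau> w < \<infinity>} w * emeasure (P (Xat \<tau> w)) B \<partial>P x)"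
    by (rule markov_property[OF x top B])
  also have "\<dots> = (\<integral>\<^sup>+ w. 0 \<partial>P x)"
    using C(2) by (intro nn_integral_cong_AE) (auto simp: PB elim: eventually_mono)
  finally have *: "emeasure (P x) {w \<in> Omega S. \<tau> w < \<infinity> \<and> \<theta> w \<in> B} = 0" by simp
  have "{w \<in> Omega S. \<tau> w < \<infinity> \<and> \<theta> w \<in> B} = {w \<in> space (FF S). \<tau> w < \<infinity> \<and> \<theta> w \<in> B}"
    by (simp add: space_FF)
  also have "\<dots> \<in> sets (FF S)" using B by measurable
  finally have "AE w in P x. w \<notin> {w \<in> Omega S. \<tau> w < \<infinity> \<and> \<theta> w \<in> B}"
    using * sets_P[OF x] by (intro AE_not_in) auto
  with AE_tau_finite[OF x] AE_space show ?thesis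
    by eventually_elim (auto simp: B_def space_P[OF x] shift_in_Omega)
qed

lemma measurable_shift_funpow [measurable]: "\<theta> ^^ k \<in> measurable (FF S) (FF S)"
proof (induction k)
  case (Suc k)
  show ?case unfolding funpow.simps by (rule measurable_comp[OF Suc measurable_shift])
qed (simp add: id_def)

text \<open>\<open>C\<close> is a closed class of the chain: started in it, the chain never leaves,
  so a property that is almost sure from each point of \<open>C\<close> survives any number of
  switches.\<close>

lemma AE_shift_funpow:
  assumes C: "C \<subseteq> D" "\<And>d. d \<in> C \<Longrightarrow> AE w in P d. Xat \<tau> w \<in> C"
    and R: "{w \<in> Omega S. R w} \<in> sets (FF S)" "\<And>d. d \<in> C \<Longrightarrow> AE w in P d. R w"
    and d: "d \<in> C"
  shows "AE w in P d. R ((\<theta> ^^ k) w)"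
  using d
proof (induction k arbitrary: d)
  case 0
  then show ?case using R(2) by simp
next
  case (Suc k)
  have "{w \<in> Omega S. R ((\<theta> ^^ k) w)} = (\<theta> ^^ k) -` {w \<in> Omega S. R w} \<inter> space (FF S)"
    using measurable_space[OF measurable_shift_funpow, of _ k] by (auto simp: space_FF)
  also have "\<dots> \<in> sets (FF S)" by (rule measurable_sets[OF measurable_shift_funpow R(1)])
  finally have m: "{w \<in> Omega S. R ((\<theta> ^^ k) w)} \<in> sets (FF S)" .
  have "AE w in P d. R ((\<theta> ^^ k) (\<theta> w))"
    using Suc C D_subset by (intro AE_shift[OF _ m, of d C]) auto
  then show ?case by (simp add: funpow_swap1)
qed

lemma sets_tau_finite: "{w \<in> Omega S. \<tau> w < \<infinity>} \<in> sets (FF S)"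
proof -
  have "{w \<in> space (FF S). \<tau> w < \<infinity>} \<in> sets (FF S)" by measurable
  then show ?thesis by (simp add: space_FF)
qed

text \<open>A starting point outside \<open>D\<close> is handled by one application of
  \<open>AE_shift\<close>, after which the path starts in \<open>D\<close>.\<close>

lemma AE_all_tau_finite:
  assumes x: "x \<in> S"
  shows "AE w in P x. \<forall>k. \<tau> ((\<theta> ^^ k) w) < \<infinity>"
proof (subst AE_all_countable, intro allI)
  fix k
  have "AE w in P d. \<tau> ((\<theta> ^^ k) w) < \<infinity>" if "d \<in> D" for k d
    using that D_subset AE_Xat_D AE_tau_finite
    by (intro AE_shift_funpow[OF subset_refl _ sets_tau_finite]) auto
  moreover have "{w \<in> Omega S. \<tau> ((\<theta> ^^ k) w) < \<infinity>} \<in> sets (FF S)" for k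
  proof -
    have "{w \<in> space (FF S). \<tau> ((\<theta> ^^ k) w) < \<infinity>} \<in> sets (FF S)" by measurable
    then show ?thesis by (simp add: space_FF)
  qed
  ultimately have "AE w in P x. \<tau> ((\<theta> ^^ k) (\<theta> w)) < \<infinity>" for k
    by (intro AE_shift[OF x _ subset_refl AE_Xat_D[OF x]])
  then show "AE w in P x. \<tau> ((\<theta> ^^ k) w) < \<infinity>"
    using AE_tau_finite[OF x] by (cases k) (simp_all add: funpow_swap1)
qed

lemma sets_chain_event: "{w \<in> Omega S. \<tau> w < \<infinity> \<and> Xat \<tau> w = d} \<in> sets (FF S)"
proof -
  have "{w \<in> space (FF S). \<tau> w < \<infinity> \<and> Xat \<tau> w = d} \<in> sets (FF S)" by measurable
  then show ?thesis by (simp add: space_FF)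
qed

text \<open>The starting point may lie outside \<open>D\<close>; \<open>Q x\<close> is then the law
  of the position after the first switch, which \<open>cf_tendsto\<close> uses for a general
  \<open>x\<close>.\<close>

lemma chain_trans_row_sum:
  assumes x: "x \<in> S"
  shows "(\<Sum>d\<in>D. Q x d) = 1"
proof -
  interpret prob_space "P x" by (rule prob_space_P) fact
  have "prob (\<Union>d\<in>D. {w \<in> Omega S. \<tau> w < \<infinity> \<and> Xat \<tau> w = d}) = (\<Sum>d\<in>D. Q x d)"
    unfolding chain_trans_def
    using sets_chain_event
    by (intro finite_measure_finite_Union) (auto simp only: finite_D disjoint_family_on_def sets_P[OF x])
  moreover have "prob (\<Union>d\<in>D. {w \<in> Omega S. \<tau> w < \<infinity> \<and> Xat \<tau> w = d}) = 1"
  proof (subst prob_eq_1)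
    show "AE w in P x. w \<in> (\<Union>d\<in>D. {w \<in> Omega S. \<tau> w < \<infinity> \<and> Xat \<tau> w = d})"
      using AE_tau_finite[OF x] AE_Xat_D[OF x] AE_space
      by eventually_elim (auto simp: space_P[OF x])
    show "(\<Union>d\<in>D. {w \<in> Omega S. \<tau> w < \<infinity> \<and> Xat \<tau> w = d}) \<in> events"
      unfolding sets_P[OF x] by (intro sets.finite_UN sets_chain_event finite_D)
  qed
  ultimately show ?thesis by simp
qed

text \<open>From a proper closed class \<open>C\<close> all switching positions stay in
  \<open>C\<close>. Recurrence nevertheless makes the path visit a point \<open>e\<close> of
  \<open>D\<close> outside \<open>C\<close>, and every visit to \<open>D\<close> shows up as the
  start of some iterate.\<close>

lemma chain_irreducible:
  assumes C: "C \<subseteq> D" "C \<noteq> {}" and closed: "\<And>d e. d \<in> C \<Longrightarrow> e \<in> D - C \<Longrightarrow> Q d e = 0"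
  shows "C = D"
proof (rule ccontr)
  assume "C \<noteq> D"
  then obtain e where e: "e \<in> D" "e \<notin> C" using C by auto
  obtain d where d: "d \<in> C" using C by auto
  have CS: "c \<in> S" if "c \<in> C" for c using that C D_subset by auto
  have X_C: "AE w in P c. Xat \<tau> w \<in> C" if c: "c \<in> C" for c
  proof -
    interpret prob_space "P c" by (rule prob_space_P) (rule CS[OF c])
    have "AE w in P c. \<forall>e\<in>D - C. w \<notin> {w \<in> Omega S. \<tau> w < \<infinity> \<and> Xat \<tau> w = e}"
    proof (subst AE_ball_countable)
      show "countable (D - C)" by (simp add: countable_finite)
      show "\<forall>e\<in>D - C. AE w in P c. w \<notin> {w \<in> Omega S. \<tau> w < \<infinity> \<and> Xat \<tau> w = e}"
      proof
        fix e assume "e \<in> D - C"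
        then have "emeasure (P c) {w \<in> Omega S. \<tau> w < \<infinity> \<and> Xat \<tau> w = e} = 0"
          using closed[OF c] by (simp add: chain_trans_def emeasure_eq_measure)
        then show "AE w in P c. w \<notin> {w \<in> Omega S. \<tau> w < \<infinity> \<and> Xat \<tau> w = e}"
          unfolding sets_P[OF CS[OF c]]
          by (intro AE_not_in null_setsI) (simp_all only: sets_P[OF CS[OF c]] sets_chain_event)
      qed
    qed
    with AE_Xat_D[OF CS[OF c]] AE_tau_finite[OF CS[OF c]] AE_space show ?thesis
      by eventually_elim (auto simp: space_P[OF CS[OF c]])
  qed
  have "{w \<in> space (FF S). w 0 \<in> C} \<in> sets (FF S)"
  proof -
    have [measurable]: "C \<in> sets borel"
      using finite_subset[OF C(1) finite_D] by (intro borel_closed finite_imp_closed)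
    show ?thesis by measurable
  qed
  then have C_sets: "{w \<in> Omega S. w 0 \<in> C} \<in> sets (FF S)" by (simp add: space_FF)
  interpret prob_space "P d" by (rule prob_space_P) (rule CS[OF d])
  have "AE w in P d. (\<theta> ^^ k) w 0 \<in> C" for k
  proof (rule AE_shift_funpow[OF C(1) X_C C_sets _ d])
    fix c assume "c \<in> C"
    then show "AE w in P c. w 0 \<in> C" using AE_start[OF CS[OF \<open>c \<in> C\<close>]] by (auto elim: eventually_mono)
  qed
  then have "AE w in P d. \<forall>k. (\<theta> ^^ k) w 0 \<in> C" by (simp add: AE_all_countable)
  moreover have "AE w in P d. \<exists>t\<ge>0. w t = e" using AE_visits[OF CS[OF d], of e] e D_subset by auto
  ultimately have "AE w in P d. False"
    using AE_all_tau_finite[OF CS[OF d]] AE_start[OF CS[OF d]] AE_space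
  proof eventually_elim
    case (elim w)
    then obtain t where t: "t \<ge> 0" "w t = e" by auto
    have "\<exists>k. (\<theta> ^^ k) w 0 = w t"
    proof (rule continuous_path_iterates_visit[OF finite_D, of w S])
      show "w \<in> Omega S" using elim by (simp add: space_P[OF CS[OF d]])
      show "w 0 \<in> D" using elim d C by auto
      show "w t \<in> D" using t e by simp
    qed (use elim t in auto)
    then show False using elim(1) t e by metis
  qed
  then show False by (simp add: AE_const)
qed

end

section \<open>Finite stochastic matrices\<close>

text \<open>Bolzano-Weierstrass, one index of \<open>D\<close> at a time; passing to further
  subsequences keeps the limits already obtained.\<close>

lemma finite_family_convergent_subseq:
  fixes f :: "nat \<Rightarrow> 'a \<Rightarrow> real"
  assumes "finite D" "\<And>n d. d \<in> D \<Longrightarrow> \<bar>f n d\<bar> \<le> B"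
  shows "\<exists>r. strict_mono r \<and> (\<forall>d\<in>D. convergent (\<lambda>n. f (r n) d))"
  using assms
proof (induction D rule: finite_induct)
  case empty
  then show ?case by (auto intro!: exI[of _ id] simp: strict_mono_def)
next
  case (insert d D)
  then obtain r where r: "strict_mono r" "\<forall>e\<in>D. convergent (\<lambda>n. f (r n) e)" by auto
  have "bounded (range (\<lambda>n. f (r n) d))"
    using insert.prems by (auto simp: bounded_iff)
  then obtain l r' where r': "strict_mono r'" "((\<lambda>n. f (r n) d) \<circ> r') \<longlonglongrightarrow> l"
    using bounded_imp_convergent_subsequence by blast
  have "convergent (\<lambda>n. f (r (r' n)) e)" if "e \<in> D" for e
    using convergent_subseq_convergent[OF bspec[OF r(2) that] r'(1)] by (simp add: o_def)
  moreover have "convergent (\<lambda>n. f (r (r' n)) d)"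
    using r'(2) by (auto simp: o_def convergent_def)
  moreover have "strict_mono (\<lambda>n. r (r' n))" using r(1) r'(1) by (auto simp: strict_mono_def)
  ultimately show ?case by (intro exI[of _ "\<lambda>n. r (r' n)"]) auto
qed

text \<open>Irreducibility is encoded as the absence of proper nonempty closed classes: the path
  argument delivers this form and the maximum principle consumes it.\<close>

locale irreducible_stochastic_matrix =
  fixes D :: "'a set" and Q :: "'a \<Rightarrow> 'a \<Rightarrow> real"
  assumes finite_D: "finite D"
    and nonneg: "\<And>d e. d \<in> D \<Longrightarrow> e \<in> D \<Longrightarrow> 0 \<le> Q d e"
    and row_sum: "\<And>d. d \<in> D \<Longrightarrow> (\<Sum>e\<in>D. Q d e) = 1"
    and irreducible: "\<And>C. C \<subseteq> D \<Longrightarrow> C \<noteq> {} \<Longrightarrow>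
      (\<And>d e. d \<in> C \<Longrightarrow> e \<in> D - C \<Longrightarrow> Q d e = 0) \<Longrightarrow> C = D"
begin

text \<open>Maximum principle: where \<open>f\<close> attains its maximum \<open>m\<close>, the
  \<open>Q\<close>-average of the nonnegative function \<open>m - f\<close> vanishes, so no mass
  leaves the set of maximisers. That set is closed, hence all of \<open>D\<close>.\<close>

lemma harmonic_imp_constant:
  assumes h: "\<And>d. d \<in> D \<Longrightarrow> (\<Sum>e\<in>D. Q d e * f e) = f d" and "a \<in> D" "b \<in> D"
  shows "f a = f b"
proof -
  define m where "m = Max (f ` D)"
  define C where "C = {d \<in> D. f d = m}"
  have le: "f d \<le> m" if "d \<in> D" for d
    unfolding m_def using finite_D that by (intro Max_ge) auto
  have "m \<in> f ` D" unfolding m_def using finite_D \<open>a \<in> D\<close> by (intro Max_in) auto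
  then have "C \<noteq> {}" by (auto simp: C_def)
  moreover have "Q d e = 0" if "d \<in> C" "e \<in> D - C" for d e
  proof -
    have d: "d \<in> D" "f d = m" using that by (auto simp: C_def)
    have "(\<Sum>e\<in>D. Q d e * (m - f e)) = 0"
      using h[OF d(1)] row_sum[OF d(1)] d(2) by (simp add: algebra_simps sum_subtractf flip: sum_distrib_left)
    then have "Q d e * (m - f e) = 0"
      using sum_nonneg_eq_0_iff[OF finite_D, of "\<lambda>e. Q d e * (m - f e)"] nonneg[OF d(1)] le that(2)
      by auto
    then show ?thesis using that(2) by (auto simp: C_def)
  qed
  ultimately have "C = D" by (intro irreducible) (auto simp: C_def)
  then have "a \<in> C" "b \<in> C" using \<open>a \<in> D\<close> \<open>b \<in> D\<close> by auto
  then show ?thesis by (simp add: C_def)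
qed

text \<open>The Cesaro means of \<open>(\<Sum>k<j. Q\<^sup>k g)\<close> solve the Poisson equation up to the
  averages \<open>A N\<close> of \<open>Q\<^sup>k g\<close>. Every limit point of these averages is harmonic, hence
  constant, hence zero as its mean is zero.\<close>
lemma poisson_equation_approx:
  assumes p: "\<And>d. d \<in> D \<Longrightarrow> 0 \<le> p d" "(\<Sum>d\<in>D. p d) = 1"
    and inv: "\<And>e. e \<in> D \<Longrightarrow> (\<Sum>d\<in>D. p d * Q d e) = p e"
    and g: "(\<Sum>d\<in>D. p d * g d) = 0" and \<eta>: "0 < (\<eta>::real)"
  shows "\<exists>c. \<forall>d\<in>D. \<bar>c d - (\<Sum>e\<in>D. Q d e * c e) - g d\<bar> \<le> \<eta>"
proof -
  define L where "L f d = (\<Sum>e\<in>D. Q d e * f e)" for f d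
  define G where "G k = (L ^^ k) g" for k
  define A where "A N d = (\<Sum>k<N. G k d) / real N" for N d
  define c where "c N d = (\<Sum>j<N. \<Sum>k<j. G k d) / real N" for N d
  have G_Suc: "G (Suc k) = L (G k)" for k by (simp add: G_def)
  have L_sum: "L (\<lambda>d. \<Sum>k\<in>K. f k d) d = (\<Sum>k\<in>K. L (f k) d)" for K :: "nat set" and f d
    unfolding L_def sum_distrib_left by (rule sum.swap)
  have L_div: "L (\<lambda>d. f d / r) d = L f d / r" for f r d
    by (simp add: L_def sum_divide_distrib)
  define B where "B = Max (insert 0 ((\<lambda>d. \<bar>g d\<bar>) ` D))"
  have G_bound: "\<bar>G k d\<bar> \<le> B" if "d \<in> D" for k d
    using that
  proof (induction k arbitrary: d)
    case 0
    then show ?case unfolding B_def G_def using finite_D by (intro Max_ge) auto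
  next
    case (Suc k)
    have "\<bar>L (G k) d\<bar> \<le> (\<Sum>e\<in>D. \<bar>Q d e * G k e\<bar>)" unfolding L_def by (rule sum_abs)
    also have "\<dots> \<le> (\<Sum>e\<in>D. Q d e * B)"
      using Suc nonneg by (intro sum_mono) (auto simp: abs_mult intro!: mult_left_mono)
    also have "\<dots> = B" using row_sum[OF Suc.prems] by (simp flip: sum_distrib_right)
    finally show ?case by (simp add: G_Suc)
  qed
  have G_mean: "(\<Sum>d\<in>D. p d * G k d) = 0" for k
  proof (induction k)
    case 0 then show ?case by (simp add: G_def g)
  next
    case (Suc k)
    have "(\<Sum>d\<in>D. p d * G (Suc k) d) = (\<Sum>d\<in>D. \<Sum>e\<in>D. p d * Q d e * G k e)"
      by (simp add: G_Suc L_def sum_distrib_left mult.assoc)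
    also have "\<dots> = (\<Sum>e\<in>D. (\<Sum>d\<in>D. p d * Q d e) * G k e)"
      by (subst sum.swap) (simp add: sum_distrib_right)
    also have "\<dots> = 0" using inv Suc by simp
    finally show ?case .
  qed
  have A_bound: "\<bar>A N d\<bar> \<le> B" if "d \<in> D" for N d
  proof (cases "N = 0")
    case True
    \<comment> \<open>For \<open>N = 0\<close> the average is 0, division by zero being 0, and the
      bound on \<open>G 0\<close> yields \<open>0 \<le> B\<close>.\<close>
    then show ?thesis using G_bound[OF that, of 0] by (simp add: A_def)
  next
    case False
    have "\<bar>\<Sum>k<N. G k d\<bar> \<le> (\<Sum>k<N. B)"
      using G_bound[OF that] by (intro order_trans[OF sum_abs] sum_mono) auto
    then show ?thesis using False by (simp add: A_def field_simps)
  qed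
  have A_mean: "(\<Sum>d\<in>D. p d * A N d) = 0" for N
  proof -
    have "(\<Sum>d\<in>D. p d * A N d) = (\<Sum>k<N. \<Sum>d\<in>D. p d * G k d) / real N"
      by (subst sum.swap) (simp add: A_def sum_divide_distrib sum_distrib_left)
    then show ?thesis by (simp add: G_mean)
  qed
  \<comment> \<open>Applying \<open>Q\<close> shifts the index of summation, so the sum telescopes
    up to two boundary terms. These are bounded by \<open>2 * B\<close>, and division by
    \<open>N\<close> makes the limit points harmonic.\<close>
  have L_A: "L (A N) d = A N d + (G N d - g d) / real N" for N d
  proof -
    have "A N = (\<lambda>d. (\<Sum>k<N. G k d) / real N)" by (simp add: A_def fun_eq_iff)
    then have eq: "L (A N) d = (\<Sum>k<N. G (Suc k) d) / real N" by (simp only: L_div L_sum G_Suc)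
    have "(\<Sum>k<N. G (Suc k) d) = (\<Sum>k<N. G k d) + (G N d - G 0 d)"
      using sum_lessThan_telescope[of "\<lambda>k. G k d" N] by (simp add: sum_subtractf)
    then show ?thesis unfolding eq by (simp add: A_def add_divide_distrib diff_divide_distrib G_def)
  qed
  have c_eq: "c N d - L (c N) d - g d = - A N d" if "N > 0" for N d
  proof -
    have "c N = (\<lambda>d. (\<Sum>j<N. \<Sum>k<j. G k d) / real N)" by (simp add: c_def fun_eq_iff)
    then have "L (c N) d = (\<Sum>j<N. \<Sum>k<j. G (Suc k) d) / real N" by (simp only: L_div L_sum G_Suc)
    also have "(\<Sum>j<N. \<Sum>k<j. G (Suc k) d) = (\<Sum>j<N. (\<Sum>k<j. G k d) + (G j d - g d))"
    proof (rule sum.cong[OF refl])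
      fix j
      show "(\<Sum>k<j. G (Suc k) d) = (\<Sum>k<j. G k d) + (G j d - g d)"
        using sum_lessThan_telescope[of "\<lambda>k. G k d" j] by (simp add: sum_subtractf G_def)
    qed
    also have "\<dots> / real N = c N d + A N d - g d"
      using that by (simp add: c_def A_def sum.distrib sum_subtractf field_simps)
    finally show ?thesis by simp
  qed
  obtain r where r: "strict_mono r" "\<forall>d\<in>D. convergent (\<lambda>n. A (r n) d)"
    using finite_family_convergent_subseq[OF finite_D, of A B] A_bound by blast
  define f where "f d = lim (\<lambda>n. A (r n) d)" for d
  have f: "(\<lambda>n. A (r n) d) \<longlonglongrightarrow> f d" if "d \<in> D" for d
    using r(2) that by (simp add: f_def convergent_LIMSEQ_iff)
  have harm: "L f d = f d" if d: "d \<in> D" for d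
  proof -
    have "(\<lambda>n. L (A (r n)) d) \<longlonglongrightarrow> L f d"
      unfolding L_def by (intro tendsto_sum tendsto_mult tendsto_const f)
    moreover have "(\<lambda>n. A (r n) d + (G (r n) d - g d) / real (r n)) \<longlonglongrightarrow> f d + 0"
    proof (intro tendsto_add f d)
      have "(\<lambda>N. (G N d - g d) / real N) \<longlonglongrightarrow> 0"
      proof (rule Lim_null_comparison)
        have "\<bar>G N d - g d\<bar> \<le> 2 * B" for N
          using G_bound[OF d, of N] G_bound[OF d, of 0] by (simp add: G_def)
        then show "\<forall>\<^sub>F N in sequentially. norm ((G N d - g d) / real N) \<le> (2 * B) / real N"
          by (intro always_eventually allI) (simp add: divide_right_mono)
        show "(\<lambda>N. (2 * B) / real N) \<longlonglongrightarrow> 0" by (rule lim_const_over_n)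
      qed
      then show "(\<lambda>n. (G (r n) d - g d) / real (r n)) \<longlonglongrightarrow> 0"
        by (rule filterlim_compose[OF _ filterlim_subseq[OF r(1)]])
    qed
    ultimately show ?thesis by (simp only: L_A add_0_right) (rule LIMSEQ_unique)
  qed
  have f0: "f d = 0" if d: "d \<in> D" for d
  proof -
    have "(\<lambda>n. \<Sum>d\<in>D. p d * A (r n) d) \<longlonglongrightarrow> (\<Sum>d\<in>D. p d * f d)"
      by (intro tendsto_sum tendsto_mult tendsto_const f)
    then have "(\<Sum>d\<in>D. p d * f d) = 0"
      by (simp add: A_mean LIMSEQ_const_iff)
    moreover have "f e = f d" if "e \<in> D" for e
      by (rule harmonic_imp_constant[OF _ that d]) (rule harm[unfolded L_def])
    ultimately have "(\<Sum>e\<in>D. p e) * f d = 0" by (simp add: sum_distrib_right)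
    then show ?thesis using p(2) by simp
  qed
  have "\<forall>\<^sub>F n in sequentially. \<forall>d\<in>D. \<bar>A (r n) d\<bar> < \<eta>"
    unfolding eventually_ball_finite_distrib[OF finite_D]
    using f f0 \<eta> by (auto simp: tendsto_iff dist_real_def)
  \<comment> \<open>\<open>c_eq\<close> requires a positive number of averaged terms.\<close>
  moreover have "\<forall>\<^sub>F n in sequentially. r n > 0"
    using eventually_gt_at_top[of 0] by eventually_elim (rule less_le_trans[OF _ seq_suble[OF r(1)]])
  ultimately have "\<forall>\<^sub>F n in sequentially. (\<forall>d\<in>D. \<bar>A (r n) d\<bar> < \<eta>) \<and> r n > 0"
    by (rule eventually_conj)
  then obtain n where n: "\<forall>d\<in>D. \<bar>A (r n) d\<bar> < \<eta>" "r n > 0"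
    using eventually_happens trivial_limit_sequentially by blast
  show ?thesis
    using n c_eq[OF n(2)] unfolding L_def by (intro exI[of _ "c (r n)"]) (auto simp: less_imp_le)
qed

end

section \<open>Powers of perturbed stochastic matrices\<close>

text \<open>The test vector \<open>1 + t\<^sup>2 c / (n + 1)\<close>, with \<open>c\<close> an approximate solution of the Poisson
  equation, is an eigenvector of \<open>M n\<close> up to \<open>o(1/n)\<close>, and contractivity makes the
  errors of the \<open>n\<close> steps add up.\<close>
lemma perturbed_matrix_power_limit:
  fixes M :: "nat \<Rightarrow> 'a \<Rightarrow> 'a \<Rightarrow> complex" and Q :: "'a \<Rightarrow> 'a \<Rightarrow> real"
    and \<phi> :: "nat \<Rightarrow> nat \<Rightarrow> 'a \<Rightarrow> complex" and t v :: real
  assumes D: "finite D" and v: "0 \<le> v"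
    and \<phi>_0: "\<And>n d. d \<in> D \<Longrightarrow> \<phi> n 0 d = 1"
    and \<phi>_Suc: "\<And>n k d. d \<in> D \<Longrightarrow> \<phi> n (Suc k) d = (\<Sum>e\<in>D. M n d e * \<phi> n k e)"
    and contr: "\<And>n d. d \<in> D \<Longrightarrow> (\<Sum>e\<in>D. norm (M n d e)) \<le> 1"
    and lim1: "\<And>d. d \<in> D \<Longrightarrow>
      (\<lambda>n. of_nat (Suc n) * ((\<Sum>e\<in>D. M n d e) - 1)) \<longlonglongrightarrow> of_real (- t\<^sup>2 / 2 * b d)"
    and lim0: "\<And>d e. d \<in> D \<Longrightarrow> e \<in> D \<Longrightarrow> (\<lambda>n. M n d e) \<longlonglongrightarrow> of_real (Q d e)"
    and poisson: "\<And>\<eta>::real. 0 < \<eta> \<Longrightarrow> \<exists>c. \<forall>d\<in>D. \<bar>c d - (\<Sum>e\<in>D. Q d e * c e) - (v - b d) / 2\<bar> \<le> \<eta>"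
    and d: "d \<in> D"
  shows "(\<lambda>n. \<phi> n n d) \<longlonglongrightarrow> of_real (exp (- t\<^sup>2 * v / 2))"
proof (rule LIM_zero_cancel, rule tendstoI)
  fix \<epsilon> :: real assume \<epsilon>: "0 < \<epsilon>"
  \<comment> \<open>Chosen so that t^2 \<eta> + \<eta> is half of \<epsilon>: the first term bounds
    the limit of the scaled residual, the second is slack for finite \<open>n\<close>.\<close>
  define \<eta> where "\<eta> = \<epsilon> / 2 / (t\<^sup>2 + 1)"
  have t2: "0 < t\<^sup>2 + 1" by (simp add: add_nonneg_pos)
  then have \<eta>: "0 < \<eta>" using \<epsilon> by (simp add: \<eta>_def)
  have "x * (\<epsilon> / 2 / x) = \<epsilon> / 2" if "0 < x" for x using that by simp
  from this[OF t2] have \<eta>_eq: "(t\<^sup>2 + 1) * \<eta> = \<epsilon> / 2" unfolding \<eta>_def .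
  obtain c where c: "\<And>d. d \<in> D \<Longrightarrow> \<bar>c d - (\<Sum>e\<in>D. Q d e * c e) - (v - b d) / 2\<bar> \<le> \<eta>"
    using poisson[OF \<eta>] by blast
  \<comment> \<open>\<open>\<rho> n\<close> is the intended eigenvalue, \<open>u n\<close> the test
    vector and \<open>r n\<close> the residual of the eigenvector equation.\<close>
  define \<rho> where "\<rho> n = exp (- (t\<^sup>2 * v / 2) / real (Suc n))" for n
  define u where "u n d = complex_of_real (1 + t\<^sup>2 * c d / real (Suc n))" for n d
  define r where "r n d = (\<Sum>e\<in>D. M n d e * u n e) - of_real (\<rho> n) * u n d" for n d
  have \<rho>01: "0 \<le> \<rho> n" "\<rho> n \<le> 1" for n using v by (auto simp: \<rho>_def)
  have \<rho>_lim: "\<rho> \<longlonglongrightarrow> 1"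
  proof -
    have "(\<lambda>n. - (t\<^sup>2 * v / 2) / real (Suc n)) \<longlonglongrightarrow> 0"
      by (rule LIMSEQ_Suc[OF lim_const_over_n])
    from tendsto_exp[OF this] show ?thesis by (simp add: \<rho>_def[abs_def])
  qed
  have \<rho>_lim1: "(\<lambda>n. real (Suc n) * (1 - \<rho> n)) \<longlonglongrightarrow> t\<^sup>2 * v / 2"
    unfolding \<rho>_def by real_asymp
  have \<rho>_pow: "(\<lambda>n. \<rho> n ^ n) \<longlonglongrightarrow> exp (- t\<^sup>2 * v / 2)"
  proof -
    have eq: "\<rho> n ^ n = exp (- (t\<^sup>2 * v / 2) * (real n / real (Suc n)))" for n
      unfolding \<rho>_def exp_of_nat_mult[symmetric] by (simp add: mult.commute)
    have "(\<lambda>n. exp (- (t\<^sup>2 * v / 2) * (real n / real (Suc n)))) \<longlonglongrightarrow> exp (- (t\<^sup>2 * v / 2) * 1)"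
      by (intro tendsto_exp tendsto_mult tendsto_const LIMSEQ_n_over_Suc_n)
    moreover have "- (t\<^sup>2 * v / 2) * 1 = - t\<^sup>2 * v / 2" by simp
    ultimately show ?thesis unfolding eq by (simp only:)
  qed
  \<comment> \<open>After scaling by n + 1 four terms survive: -t^2 b/2 from the row sums, t^2 Q c
    from the correction of the test vector, t^2 v/2 from \<open>1 - \<rho> n\<close>, and -t^2 c
    from \<open>\<rho> n\<close> acting on that correction. Together they are -t^2 times the defect
    of \<open>c\<close> in the Poisson equation.\<close>
  have r_lim: "(\<lambda>n. of_nat (Suc n) * r n d) \<longlonglongrightarrow>
      of_real (- t\<^sup>2 * (c d - (\<Sum>e\<in>D. Q d e * c e) - (v - b d) / 2))" if d: "d \<in> D" for d
  proof -
    have "of_nat (Suc n) * r n d = of_nat (Suc n) * ((\<Sum>e\<in>D. M n d e) - 1)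
        + of_real (t\<^sup>2) * (\<Sum>e\<in>D. M n d e * of_real (c e))
        + of_real (real (Suc n) * (1 - \<rho> n)) - of_real (\<rho> n) * of_real (t\<^sup>2 * c d)" for n
    proof -
      define N where "N = real (Suc n)"
      have N: "N \<noteq> 0" "complex_of_nat (Suc n) = of_real N" by (simp_all add: N_def)
      have u_N: "of_real N * u n e = of_real (N + t\<^sup>2 * c e)" for e
        unfolding u_def N_def[symmetric] of_real_mult[symmetric] using N(1) by (simp add: field_simps)
      have "of_real N * r n d =
        (\<Sum>e\<in>D. M n d e * of_real (N + t\<^sup>2 * c e)) - of_real (\<rho> n) * of_real (N + t\<^sup>2 * c d)"
        unfolding r_def right_diff_distrib sum_distrib_left u_N[symmetric]
        by (simp only: mult.left_commute)
      also have "\<dots> = of_real N * ((\<Sum>e\<in>D. M n d e) - 1)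
        + of_real (t\<^sup>2) * (\<Sum>e\<in>D. M n d e * of_real (c e))
        + of_real (N * (1 - \<rho> n)) - of_real (\<rho> n) * of_real (t\<^sup>2 * c d)"
        unfolding of_real_add distrib_left sum.distrib by (simp add: algebra_simps sum_distrib_left)
      finally show ?thesis unfolding N(2) N_def .
    qed
    moreover have "(\<lambda>n. of_nat (Suc n) * ((\<Sum>e\<in>D. M n d e) - 1)
        + of_real (t\<^sup>2) * (\<Sum>e\<in>D. M n d e * of_real (c e))
        + of_real (real (Suc n) * (1 - \<rho> n)) - of_real (\<rho> n) * of_real (t\<^sup>2 * c d)) \<longlonglongrightarrow>
       of_real (- t\<^sup>2 / 2 * b d) + of_real (t\<^sup>2) * (\<Sum>e\<in>D. of_real (Q d e) * of_real (c e))
        + of_real (t\<^sup>2 * v / 2) - of_real 1 * of_real (t\<^sup>2 * c d)"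
      using d by (intro tendsto_intros lim1 lim0 \<rho>_lim \<rho>_lim1)
    moreover have "of_real (- t\<^sup>2 / 2 * b d) + of_real (t\<^sup>2) * (\<Sum>e\<in>D. of_real (Q d e) * of_real (c e))
        + of_real (t\<^sup>2 * v / 2) - of_real 1 * of_real (t\<^sup>2 * c d)
        = complex_of_real (- t\<^sup>2 * (c d - (\<Sum>e\<in>D. Q d e * c e) - (v - b d) / 2))"
      by (simp add: field_simps)
    ultimately show ?thesis by simp
  qed
  \<comment> \<open>Rows of \<open>M n\<close> have total norm at most 1 and \<open>\<rho> n\<close>
    is at most 1, so a step does not enlarge the previous error and adds at most one residual
    \<open>R\<close>; \<open>C\<close> is the error of replacing 1 by \<open>u n\<close> at the
    start.\<close>
  have bound: "norm (\<phi> n k d - of_real (\<rho> n ^ k) * u n d) \<le> C + real k * R"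
    if d: "d \<in> D" and C: "\<And>e. e \<in> D \<Longrightarrow> norm (1 - u n e) \<le> C" and R: "\<And>e. e \<in> D \<Longrightarrow> norm (r n e) \<le> R"
    for n k C R d
    using d
  proof (induction k arbitrary: d)
    case 0
    then show ?case using C by (simp add: \<phi>_0)
  next
    case (Suc k)
    have nn: "0 \<le> C + real k * R" using Suc order_trans[OF norm_ge_zero] by blast
    have "\<phi> n (Suc k) d - of_real (\<rho> n ^ Suc k) * u n d =
        (\<Sum>e\<in>D. M n d e * (\<phi> n k e - of_real (\<rho> n ^ k) * u n e)) + of_real (\<rho> n ^ k) * r n d"
      using Suc.prems by (simp add: \<phi>_Suc r_def algebra_simps sum_subtractf sum_distrib_left)
    also have "norm \<dots> \<le> (\<Sum>e\<in>D. norm (M n d e) * (C + real k * R)) + norm (r n d)"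
    proof (rule norm_triangle_mono)
      show "norm (\<Sum>e\<in>D. M n d e * (\<phi> n k e - of_real (\<rho> n ^ k) * u n e)) \<le> (\<Sum>e\<in>D. norm (M n d e) * (C + real k * R))"
        using Suc.IH by (intro sum_norm_le) (simp add: norm_mult mult_left_mono)
      show "norm (of_real (\<rho> n ^ k) * r n d) \<le> norm (r n d)"
        using \<rho>01[of n] by (simp add: norm_mult norm_power mult_left_le_one_le power_le_one)
    qed
    also have "\<dots> \<le> 1 * (C + real k * R) + R"
      unfolding sum_distrib_right[symmetric]
      using contr[OF Suc.prems] R[OF Suc.prems] nn by (intro add_mono mult_right_mono)
    finally show ?case by (simp add: algebra_simps)
  qed
  have ev_r: "\<forall>\<^sub>F n in sequentially. \<forall>d\<in>D. norm (of_nat (Suc n) * r n d) < t\<^sup>2 * \<eta> + \<eta>"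
    unfolding eventually_ball_finite_distrib[OF D]
  proof
    fix d assume d: "d \<in> D"
    have "norm (complex_of_real (- t\<^sup>2 * (c d - (\<Sum>e\<in>D. Q d e * c e) - (v - b d) / 2))) \<le> t\<^sup>2 * \<eta>"
      using c[OF d] unfolding norm_of_real abs_mult by (simp add: mult_left_mono)
    then show "\<forall>\<^sub>F n in sequentially. norm (of_nat (Suc n) * r n d) < t\<^sup>2 * \<eta> + \<eta>"
      using \<eta> by (intro order_tendstoD(2)[OF tendsto_norm[OF r_lim[OF d]]]) simp
  qed
  define C where "C n = (\<Sum>e\<in>D. \<bar>t\<^sup>2 * c e\<bar>) / real (Suc n)" for n
  have C_lim: "C \<longlonglongrightarrow> 0"
    unfolding C_def[abs_def] by (rule LIMSEQ_Suc[OF lim_const_over_n])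
  have uC: "norm (1 - u n e) \<le> C n" if "e \<in> D" for n e
  proof -
    have "1 - u n e = of_real (- (t\<^sup>2 * c e / real (Suc n)))" by (simp add: u_def)
    then have "norm (1 - u n e) = \<bar>t\<^sup>2 * c e\<bar> / real (Suc n)"
      by (simp only: norm_of_real abs_minus_cancel abs_divide abs_of_nat)
    also have "\<dots> \<le> C n"
      unfolding C_def using D that by (intro divide_right_mono member_le_sum) auto
    finally show ?thesis .
  qed
  have u_lim: "(\<lambda>n. u n d) \<longlonglongrightarrow> 1"
  proof (rule LIM_zero_cancel, rule Lim_null_comparison[OF _ C_lim])
    show "\<forall>\<^sub>F n in sequentially. norm (u n d - 1) \<le> C n"
      using uC[OF d] by (intro always_eventually allI) (simp only: norm_minus_commute)
  qed
  have "(\<lambda>n. of_real (\<rho> n ^ n) * u n d) \<longlonglongrightarrow> of_real (exp (- t\<^sup>2 * v / 2)) * 1"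
    by (intro tendsto_mult tendsto_of_real \<rho>_pow u_lim)
  then have "(\<lambda>n. C n + norm (of_real (\<rho> n ^ n) * u n d - of_real (exp (- t\<^sup>2 * v / 2)))) \<longlonglongrightarrow> 0 + 0"
    by (intro tendsto_add C_lim tendsto_norm_zero LIM_zero) simp
  then have ev_s: "\<forall>\<^sub>F n in sequentially.
      C n + norm (of_real (\<rho> n ^ n) * u n d - of_real (exp (- t\<^sup>2 * v / 2))) < \<epsilon> / 2"
    using \<epsilon> by (intro order_tendstoD(2)) auto
  show "\<forall>\<^sub>F n in sequentially. dist (\<phi> n n d - of_real (exp (- t\<^sup>2 * v / 2))) 0 < \<epsilon>"
    using ev_r ev_s
  proof eventually_elim
    case (elim n)
    define R where "R = (t\<^sup>2 * \<eta> + \<eta>) / real (Suc n)"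
    have "norm (r n e) \<le> R" if "e \<in> D" for e
      using elim(1) that by (auto simp: R_def norm_mult field_simps simp del: of_nat_Suc intro!: less_imp_le)
    from bound[OF d uC this] have "norm (\<phi> n n d - of_real (\<rho> n ^ n) * u n d) \<le> C n + real n * R" by blast
    also have "real n * R \<le> real (Suc n) * R"
      using \<eta> by (intro mult_right_mono) (auto simp: R_def)
    also have "real (Suc n) * R = t\<^sup>2 * \<eta> + \<eta>" by (simp add: R_def del: of_nat_Suc)
    also have "\<dots> = (t\<^sup>2 + 1) * \<eta>" by (simp add: algebra_simps)
    also have "\<dots> = \<epsilon> / 2" by (rule \<eta>_eq)
    finally have "norm (\<phi> n n d - of_real (\<rho> n ^ n) * u n d) \<le> C n + \<epsilon> / 2" by simp
    then show ?case
      using elim(2) norm_triangle_ineq[of "\<phi> n n d - of_real (\<rho> n ^ n) * u n d" "of_real (\<rho> n ^ n) * u n d - of_real (exp (- t\<^sup>2 * v / 2))"]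
      by (simp add: dist_norm)
  qed
qed

section \<open>Characteristic functions along the chain\<close>

text \<open>Pushing a measure forward along the identity restricts it to the smaller sigma-algebra
  \<open>Ftau\<close>.\<close>

lemma measurable_id_Ftau:
  assumes "sets M = sets (FF S)"
  shows "(\<lambda>w. w) \<in> measurable M (Ftau S \<sigma>)"
proof (rule measurableI)
  have sp: "space M = Omega S" using sets_eq_imp_space_eq[OF assms] by (simp only: space_FF)
  show "w \<in> space (Ftau S \<sigma>)" if "w \<in> space M" for w
    using that by (simp only: sp space_Ftau)
  fix A assume "A \<in> sets (Ftau S \<sigma>)"
  then have A: "A \<in> sets (FF S)" using sets_Ftau_subset by blast
  then have "A \<subseteq> Omega S" using sets.sets_into_space[OF A] by (simp only: space_FF)
  then have "(\<lambda>w. w) -` A \<inter> space M = A" unfolding sp by blast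
  then show "(\<lambda>w. w) -` A \<inter> space M \<in> sets M" using A by (simp only: assms)
qed

context recurrent_diffusion
begin

definition switch_to :: "real \<Rightarrow> path set" where
  "switch_to d = {w \<in> Omega S. \<tau> w < \<infinity> \<and> Xat \<tau> w = d}"

lemma sets_switch_to [measurable]: "switch_to d \<in> sets (FF S)"
  unfolding switch_to_def by (rule sets_chain_event)

text \<open>\<open>markov_property_at\<close> says on rectangles that, restricted to
  \<open>switch_to d\<close>, the joint law of \<open>w\<close> on \<open>Ftau\<close> and of
  \<open>\<theta> w\<close> on \<open>FF\<close> is a product measure. Uniqueness of product
  measures and Fubini extend this to integrals.\<close>

lemma markov_integral_at:
  fixes f g :: "path \<Rightarrow> complex"
  assumes x: "x \<in> S" and d: "d \<in> D"
    and f: "f \<in> borel_measurable (Ftau S \<tau>)" "\<And>w. norm (f w) \<le> 1"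
    and g: "g \<in> borel_measurable (FF S)" "\<And>w. norm (g w) \<le> 1"
  shows "(\<integral>w. indicator (switch_to d) w *\<^sub>R (f w * g (\<theta> w)) \<partial>P x) =
    (\<integral>w. indicator (switch_to d) w *\<^sub>R f w \<partial>P x) * (\<integral>w. g w \<partial>P d)"
proof -
  have dS: "d \<in> S" using d D_subset by auto
  note [measurable_cong] = sets_P[OF x] sets_P[OF dS]
  note [measurable] = g(1) measurable_Ftau_imp_FF[OF f(1)]
  interpret Px: prob_space "P x" by (rule prob_space_P) fact
  interpret Pd: prob_space "P d" by (rule prob_space_P) fact
  have E: "switch_to d \<in> sets (P x)" unfolding sets_P[OF x] by (rule sets_switch_to)
  \<comment> \<open>\<open>P x\<close> restricted to the switch event, a finite measure of total
    mass \<open>Q x d\<close>.\<close>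
  define R where "R = density (P x) (indicator (switch_to d))"
  have R': "R = density (P x) (\<lambda>w. ennreal (indicator (switch_to d) w))"
    by (simp add: R_def ennreal_indicator)
  have sets_R [measurable_cong]: "sets R = sets (FF S)" by (simp add: R_def sets_P[OF x])
  have space_R: "space R = Omega S" using sets_eq_imp_space_eq[OF sets_R] by (simp add: space_FF)
  interpret R: finite_measure R unfolding R_def by (rule Px.finite_measure_restricted[OF E])
  have id [measurable]: "(\<lambda>w. w) \<in> measurable R (Ftau S \<tau>)" by (rule measurable_id_Ftau[OF sets_R])
  \<comment> \<open>On \<open>Ftau\<close> the sides \<open>A\<close> of the rectangles are exactly
    the events for which the strong Markov property is available.\<close>
  define M1 where "M1 = distr R (Ftau S \<tau>) (\<lambda>w. w)"
  interpret M1: finite_measure M1 unfolding M1_def by (rule R.finite_measure_distr[OF id])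
  have sets_M1 [measurable_cong]: "sets M1 = sets (Ftau S \<tau>)" by (simp add: M1_def)
  interpret pair_sigma_finite M1 "P d" ..
  have N: "(\<lambda>w. (w, \<theta> w)) \<in> measurable R (Ftau S \<tau> \<Otimes>\<^sub>M FF S)" by measurable
  have eq: "M1 \<Otimes>\<^sub>M P d = distr R (Ftau S \<tau> \<Otimes>\<^sub>M FF S) (\<lambda>w. (w, \<theta> w))"
  proof (rule pair_measure_eqI)
    show "sets (M1 \<Otimes>\<^sub>M P d) = sets (distr R (Ftau S \<tau> \<Otimes>\<^sub>M FF S) (\<lambda>w. (w, \<theta> w)))"
      by (simp add: sets_M1 sets_P[OF dS] cong: sets_pair_measure_cong)
    fix A B assume "A \<in> sets M1" "B \<in> sets (P d)"
    then have A: "A \<in> sets (Ftau S \<tau>)" and B: "B \<in> sets (FF S)" by (simp_all add: sets_M1 sets_P[OF dS])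
    have A': "A \<in> sets (FF S)" using A sets_Ftau_subset by blast
    have A\<Omega>: "A \<subseteq> Omega S" using sets.sets_into_space[OF A'] by (simp add: space_FF)
    have B': "\<theta> -` B \<inter> Omega S \<in> sets (FF S)" using measurable_sets[OF measurable_shift B] by (simp add: space_FF)
    have "emeasure M1 A = emeasure R A"
      unfolding M1_def using A A\<Omega> by (subst emeasure_distr[OF id]) (auto simp: space_R Int_absorb2)
    also have "\<dots> = emeasure (P x) (switch_to d \<inter> A)"
      unfolding R_def using A' E by (intro emeasure_restricted) (simp_all add: sets_P[OF x])
    also have "switch_to d \<inter> A = {w \<in> A. \<tau> w < \<infinity> \<and> Xat \<tau> w = d}"
      using A\<Omega> by (auto simp: switch_to_def)
    finally have 1: "emeasure M1 A = emeasure (P x) {w \<in> A. \<tau> w < \<infinity> \<and> Xat \<tau> w = d}" .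
    have "emeasure (distr R (Ftau S \<tau> \<Otimes>\<^sub>M FF S) (\<lambda>w. (w, \<theta> w))) (A \<times> B)
        = emeasure R ((\<lambda>w. (w, \<theta> w)) -` (A \<times> B) \<inter> space R)"
      using A B by (intro emeasure_distr[OF N]) simp
    also have "(\<lambda>w. (w, \<theta> w)) -` (A \<times> B) \<inter> space R = A \<inter> (\<theta> -` B \<inter> Omega S)"
      using A\<Omega> by (auto simp: space_R)
    also have "emeasure R \<dots> = emeasure (P x) (switch_to d \<inter> (A \<inter> (\<theta> -` B \<inter> Omega S)))"
      unfolding R_def using A' B' E by (intro emeasure_restricted) (simp_all add: sets_P[OF x])
    also have "switch_to d \<inter> (A \<inter> (\<theta> -` B \<inter> Omega S)) =
        {w \<in> A. \<tau> w < \<infinity> \<and> Xat \<tau> w = d \<and> \<theta> w \<in> B}"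
      using A\<Omega> by (auto simp: switch_to_def)
    finally show "emeasure M1 A * emeasure (P d) B =
        emeasure (distr R (Ftau S \<tau> \<Otimes>\<^sub>M FF S) (\<lambda>w. (w, \<theta> w))) (A \<times> B)"
      unfolding 1 by (simp only: markov_property_at[OF x A B d])
  qed (unfold_locales)
  interpret pair: finite_measure "M1 \<Otimes>\<^sub>M P d"
    by (rule finite_measure_pair_measure) unfold_locales
  have m: "(\<lambda>y. f (fst y) * g (snd y)) \<in> borel_measurable (Ftau S \<tau> \<Otimes>\<^sub>M FF S)"
    using f(1) by measurable
  have int: "integrable (M1 \<Otimes>\<^sub>M P d) (\<lambda>y. f (fst y) * g (snd y))"
  proof (rule pair.integrable_const_bound[of _ 1])
    show "AE y in M1 \<Otimes>\<^sub>M P d. norm (f (fst y) * g (snd y)) \<le> 1"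
      using f(2) g(2) by (intro always_eventually allI) (simp add: norm_mult mult_le_one)
    show "(\<lambda>y. f (fst y) * g (snd y)) \<in> borel_measurable (M1 \<Otimes>\<^sub>M P d)"
      using m by (simp add: eq)
  qed
  have "(\<integral>w. indicator (switch_to d) w *\<^sub>R (f w * g (\<theta> w)) \<partial>P x) = (\<integral>w. f w * g (\<theta> w) \<partial>R)"
    unfolding R' by (rule integral_density[symmetric]) (use E in auto)
  also have "\<dots> = (\<integral>y. f (fst y) * g (snd y) \<partial>(M1 \<Otimes>\<^sub>M P d))"
    unfolding eq using integral_distr[OF N m] by simp
  also have "\<dots> = (\<integral>w. \<integral>v. f w * g v \<partial>P d \<partial>M1)"
    using integral_fst'[OF int] by simp
  also have "\<dots> = (\<integral>w. f w \<partial>M1) * (\<integral>v. g v \<partial>P d)" by simp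
  also have "(\<integral>w. f w \<partial>M1) = (\<integral>w. f w \<partial>R)" unfolding M1_def by (rule integral_distr[OF id f(1)])
  also have "\<dots> = (\<integral>w. indicator (switch_to d) w *\<^sub>R f w \<partial>P x)"
    unfolding R' by (rule integral_density) (use E in auto)
  finally show ?thesis .
qed

text \<open>Almost surely a path lies in \<open>switch_to d\<close> for exactly one \<open>d\<close>
  in \<open>D\<close>, so the integral splits according to the landing point.\<close>

lemma markov_integral:
  fixes f g :: "path \<Rightarrow> complex"
  assumes x: "x \<in> S"
    and f: "f \<in> borel_measurable (Ftau S \<tau>)" "\<And>w. norm (f w) \<le> 1"
    and g: "g \<in> borel_measurable (FF S)" "\<And>w. norm (g w) \<le> 1"
  shows "(\<integral>w. f w * g (\<theta> w) \<partial>P x) =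
    (\<Sum>d\<in>D. (\<integral>w. indicator (switch_to d) w *\<^sub>R f w \<partial>P x) * (\<integral>w. g w \<partial>P d))"
proof -
  note [measurable_cong] = sets_P[OF x]
  note [measurable] = g(1) measurable_Ftau_imp_FF[OF f(1)]
  interpret Px: prob_space "P x" by (rule prob_space_P) fact
  have E [measurable]: "switch_to d \<in> sets (P x)" for d unfolding sets_P[OF x] by (rule sets_switch_to)
  have "(\<integral>w. f w * g (\<theta> w) \<partial>P x) = (\<integral>w. (\<Sum>d\<in>D. indicator (switch_to d) w *\<^sub>R (f w * g (\<theta> w))) \<partial>P x)"
  proof (rule integral_cong_AE)
    show "AE w in P x. f w * g (\<theta> w) = (\<Sum>d\<in>D. indicator (switch_to d) w *\<^sub>R (f w * g (\<theta> w)))"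
      using AE_tau_finite[OF x] AE_Xat_D[OF x] AE_space
    proof eventually_elim
      case (elim w)
      have "indicator (switch_to d) w = (if d = Xat \<tau> w then 1 else 0 :: real)" for d
        using elim by (auto simp: switch_to_def space_P[OF x])
      then have "(\<Sum>d\<in>D. indicator (switch_to d) w *\<^sub>R (f w * g (\<theta> w)))
          = (\<Sum>d\<in>D. if d = Xat \<tau> w then f w * g (\<theta> w) else 0)"
        by (intro sum.cong) auto
      then show ?case using elim(2) by simp
    qed
  qed measurable
  also have "\<dots> = (\<Sum>d\<in>D. \<integral>w. indicator (switch_to d) w *\<^sub>R (f w * g (\<theta> w)) \<partial>P x)"
  proof (rule Bochner_Integration.integral_sum)
    fix d
    show "integrable (P x) (\<lambda>w. indicator (switch_to d) w *\<^sub>R (f w * g (\<theta> w)))"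
    proof (rule Px.integrable_const_bound[of _ 1])
      show "AE w in P x. norm (indicator (switch_to d) w *\<^sub>R (f w * g (\<theta> w))) \<le> 1"
        using f(2) g(2) by (intro always_eventually allI) (simp add: norm_mult mult_le_one indicator_def)
    qed measurable
  qed
  also have "\<dots> = (\<Sum>d\<in>D. (\<integral>w. indicator (switch_to d) w *\<^sub>R f w \<partial>P x) * (\<integral>w. g w \<partial>P d))"
    by (intro sum.cong markov_integral_at[OF x _ f g] refl)
  finally show ?thesis .
qed

end

section \<open>The functional \<open>Z\<close> and the kernels of its characteristic
  functions\<close>

locale recurrent_diffusion_functional = recurrent_diffusion +
  fixes Z :: "path \<Rightarrow> real"
  assumes Z_meas: "Z \<in> borel_measurable (Ftau S (tau D 2))"
begin

text \<open>Iterating one map makes splitting off the first summand an identity on all paths, with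
  no exceptional set; agreement with the sum over hitting times is needed only almost
  surely.\<close>

definition partial_sum :: "nat \<Rightarrow> path \<Rightarrow> real" where
  "partial_sum n w = (\<Sum>k<n. Z ((\<theta> ^^ k) w))"

definition cf :: "real \<Rightarrow> nat \<Rightarrow> real \<Rightarrow> complex" where
  "cf s n x = (\<integral>w. iexp (s * partial_sum n w) \<partial>P x)"

text \<open>The matrix M(s) of the overview, with rows for all points of \<open>S\<close>.\<close>

definition kern :: "real \<Rightarrow> real \<Rightarrow> real \<Rightarrow> complex" where
  "kern s x d = (\<integral>w. indicator (switch_to d) w *\<^sub>R iexp (s * Z w) \<partial>P x)"

lemma measurable_Z [measurable]: "Z \<in> borel_measurable (FF S)"
  by (rule measurable_Ftau_imp_FF[OF Z_meas])

lemma measurable_partial_sum [measurable]: "partial_sum n \<in> borel_measurable (FF S)"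
  unfolding partial_sum_def by measurable

lemma partial_sum_Suc: "partial_sum (Suc n) w = Z w + partial_sum n (\<theta> w)"
  unfolding partial_sum_def by (simp add: sum.lessThan_Suc_shift funpow_swap1 del: sum.lessThan_Suc)

text \<open>The exponential factors at the first switch into an \<open>Ftau\<close>-measurable term
  and a function of \<open>\<theta> w\<close>.\<close>

lemma cf_Suc:
  assumes x: "x \<in> S"
  shows "cf s (Suc n) x = (\<Sum>d\<in>D. kern s x d * cf s n d)"
proof -
  have "cf s (Suc n) x = (\<integral>w. iexp (s * Z w) * iexp (s * partial_sum n (\<theta> w)) \<partial>P x)"
    unfolding cf_def partial_sum_Suc by (simp add: distrib_left exp_add)
  also have "\<dots> = (\<Sum>d\<in>D. kern s x d * cf s n d)"
    unfolding kern_def cf_def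
  proof (rule markov_integral[OF x])
    show "(\<lambda>w. iexp (s * Z w)) \<in> borel_measurable (Ftau S \<tau>)" using Z_meas by measurable
  qed simp_all
  finally show ?thesis .
qed

lemma cf_0: "x \<in> S \<Longrightarrow> cf s 0 x = 1"
  using prob_space.prob_space[OF prob_space_P] by (simp add: cf_def partial_sum_def)

text \<open>The one-step recursion with an empty remaining sum: the row sum is the characteristic
  function of \<open>Z\<close>, to which a Taylor expansion applies.\<close>

lemma kern_sum:
  assumes x: "x \<in> S"
  shows "(\<Sum>d\<in>D. kern s x d) = char (distr (P x) borel Z) s"
proof -
  note [measurable_cong] = sets_P[OF x]
  have "(\<Sum>d\<in>D. kern s x d) = cf s (Suc 0) x"
    unfolding cf_Suc[OF x] using cf_0 D_subset by (intro sum.cong) auto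
  also have "\<dots> = char (distr (P x) borel Z) s"
    unfolding cf_def char_def by (subst integral_distr) (auto simp: partial_sum_def)
  finally show ?thesis .
qed

text \<open>With the row sums of \<open>Q\<close> equal to 1, this is the contraction property of
  the kernels.\<close>

lemma norm_kern_le:
  assumes x: "x \<in> S"
  shows "norm (kern s x d) \<le> Q x d"
proof -
  have "norm (kern s x d) \<le> (\<integral>w. norm (indicator (switch_to d) w *\<^sub>R iexp (s * Z w)) \<partial>P x)"
    unfolding kern_def by (rule integral_norm_bound)
  also have "\<dots> = (\<integral>w. indicator (switch_to d) w \<partial>P x)" by simp
  also have "\<dots> = measure (P x) (switch_to d)"
    using sets.sets_into_space[OF sets_switch_to, of d] by (simp add: space_FF space_P[OF x] Int_absorb1 Int_absorb2)
  finally show ?thesis by (simp add: chain_trans_def switch_to_def)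
qed

text \<open>Dominated convergence with bound 1; no moment of \<open>Z\<close> enters, so it serves
  any starting point in \<open>S\<close>.\<close>

lemma kern_tendsto:
  assumes x: "x \<in> S" and s: "s \<longlonglongrightarrow> 0"
  shows "(\<lambda>n. kern (s n) x d) \<longlonglongrightarrow> of_real (Q x d)"
proof -
  note [measurable_cong] = sets_P[OF x]
  interpret Px: prob_space "P x" by (rule prob_space_P) fact
  have [measurable]: "switch_to d \<in> sets (P x)" unfolding sets_P[OF x] by (rule sets_switch_to)
  have "(\<lambda>n. kern (s n) x d) \<longlonglongrightarrow> (\<integral>w. indicator (switch_to d) w *\<^sub>R 1 \<partial>P x)"
    unfolding kern_def
  proof (rule integral_dominated_convergence[where w = "\<lambda>_. 1"])
    show "AE w in P x. (\<lambda>n. indicator (switch_to d) w *\<^sub>R iexp (s n * Z w)) \<longlonglongrightarrow> indicator (switch_to d) w *\<^sub>R 1"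
    proof (intro always_eventually allI tendsto_scaleR tendsto_const)
      fix w
      have "(\<lambda>n. iexp (s n * Z w)) \<longlonglongrightarrow> iexp (0 * Z w)"
        by (intro isCont_tendsto_compose[OF isCont_iexp] tendsto_mult s tendsto_const)
      then show "(\<lambda>n. iexp (s n * Z w)) \<longlonglongrightarrow> 1" by simp
    qed
    show "AE w in P x. norm (indicator (switch_to d) w *\<^sub>R iexp (s n * Z w)) \<le> 1" for n
      by (intro always_eventually allI) (simp add: indicator_def)
  qed auto
  also have "(\<integral>w. indicator (switch_to d) w *\<^sub>R 1 \<partial>P x) = complex_of_real (measure (P x) (switch_to d))"
    by (simp add: scaleR_conv_of_real)
  finally show ?thesis by (simp add: chain_trans_def switch_to_def)
qed

lemma char_step_expansion:
  assumes x: "x \<in> S" and L2: "integrable (P x) (\<lambda>w. (Z w)\<^sup>2)" and mean: "(\<integral>w. Z w \<partial>P x) = 0"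
  shows "(\<lambda>n. of_nat (Suc n) * ((\<Sum>d\<in>D. kern (t / sqrt (real (Suc n))) x d) - 1)) \<longlonglongrightarrow>
    of_real (- t\<^sup>2 / 2 * (\<integral>w. (Z w)\<^sup>2 \<partial>P x))"
proof (rule LIM_zero_cancel)
  note [measurable_cong] = sets_P[OF x]
  interpret Px: prob_space "P x" by (rule prob_space_P) fact
  have rv: "Z \<in> borel_measurable (P x)" by measurable
  have L1: "integrable (P x) Z" by (rule Px.square_integrable_imp_integrable[OF rv L2])
  define b where "b = (\<integral>w. (Z w)\<^sup>2 \<partial>P x)"
  define s where "s n = t / sqrt (real (Suc n))" for n
  have s2: "real (Suc n) * (s n)\<^sup>2 = t\<^sup>2" for n
    by (simp add: s_def power_divide del: of_nat_Suc)
  have s_lim: "s \<longlonglongrightarrow> 0" unfolding s_def by real_asymp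
  \<comment> \<open>The remainder of the second-order expansion of the characteristic function. It
    is dominated by the integrable \<open>6 * (Z w)\<^sup>2\<close> and tends to 0 pointwise, so
    second moments give an error o(1/n).\<close>
  define h where "h n w = min (6 * (Z w)\<^sup>2) (\<bar>s n\<bar> * \<bar>Z w\<bar> ^ 3)" for n w
  have "(\<lambda>n. \<integral>w. h n w \<partial>P x) \<longlonglongrightarrow> (\<integral>w. 0 \<partial>P x)"
  proof (rule integral_dominated_convergence[where w = "\<lambda>w. 6 * (Z w)\<^sup>2"])
    show "integrable (P x) (\<lambda>w. 6 * (Z w)\<^sup>2)" using L2 by simp
    show "AE w in P x. (\<lambda>n. h n w) \<longlonglongrightarrow> 0"
    proof (intro always_eventually allI)
      fix w
      have "(\<lambda>n. h n w) \<longlonglongrightarrow> min (6 * (Z w)\<^sup>2) (\<bar>0\<bar> * \<bar>Z w\<bar> ^ 3)"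
        unfolding h_def by (intro tendsto_min tendsto_const tendsto_mult tendsto_rabs s_lim)
      then show "(\<lambda>n. h n w) \<longlonglongrightarrow> 0" by (simp add: min_absorb2)
    qed
    show "AE w in P x. norm (h n w) \<le> 6 * (Z w)\<^sup>2" for n
      by (intro always_eventually allI) (simp add: h_def)
  qed (auto simp: h_def)
  then have h_lim: "(\<lambda>n. t\<^sup>2 / 6 * (\<integral>w. h n w \<partial>P x)) \<longlonglongrightarrow> 0"
    by (intro tendsto_mult_right_zero) simp
  show "(\<lambda>n. of_nat (Suc n) * ((\<Sum>d\<in>D. kern (t / sqrt (real (Suc n))) x d) - 1)
      - of_real (- t\<^sup>2 / 2 * (\<integral>w. (Z w)\<^sup>2 \<partial>P x))) \<longlonglongrightarrow> 0"
    unfolding s_def[symmetric] b_def[symmetric]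
  proof (rule Lim_null_comparison[OF always_eventually h_lim], rule allI)
    fix n
    define \<psi> where "\<psi> = char (distr (P x) borel Z) (s n)"
    have "norm (\<psi> - (1 - (s n)\<^sup>2 * b / 2)) \<le> (s n)\<^sup>2 / 6 * (\<integral>w. h n w \<partial>P x)"
      unfolding \<psi>_def h_def
      by (rule Px.char_approx3'[OF rv L1 L2 mean _ refl]) (simp add: mean b_def)
    then have "real (Suc n) * norm (\<psi> - (1 - (s n)\<^sup>2 * b / 2)) \<le> real (Suc n) * ((s n)\<^sup>2 / 6 * (\<integral>w. h n w \<partial>P x))"
      by (intro mult_left_mono) auto
    also have "\<dots> = t\<^sup>2 / 6 * (\<integral>w. h n w \<partial>P x)"
      unfolding s2[of n, symmetric] by simp
    also have "real (Suc n) * norm (\<psi> - (1 - (s n)\<^sup>2 * b / 2)) = norm (of_real (real (Suc n)) * (\<psi> - (1 - (s n)\<^sup>2 * b / 2)))"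
      unfolding norm_mult norm_of_real by simp
    also have "of_real (real (Suc n)) * (\<psi> - (1 - (s n)\<^sup>2 * b / 2)) = of_nat (Suc n) * (\<psi> - 1) - of_real (- (real (Suc n) * (s n)\<^sup>2) / 2 * b)"
      by (simp add: field_simps del: of_nat_Suc)
    finally show "norm (of_nat (Suc n) * ((\<Sum>d\<in>D. kern (s n) x d) - 1) - of_real (- t\<^sup>2 / 2 * b)) \<le> t\<^sup>2 / 6 * (\<integral>w. h n w \<partial>P x)"
      unfolding s2 kern_sum[OF x] \<psi>_def by simp
  qed
qed

text \<open>One switch from \<open>x\<close> leads into \<open>D\<close> with weights tending to
  \<open>Q x d\<close>, and the remaining \<open>n\<close> switches have the same limit from every
  \<open>d\<close>. The weights sum to 1, so this is also the limit from \<open>x\<close>.\<close>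

lemma cf_tendsto:
  assumes x: "x \<in> S"
    and p: "\<And>d. d \<in> D \<Longrightarrow> 0 \<le> p d" "(\<Sum>d\<in>D. p d) = 1"
      "\<And>e. e \<in> D \<Longrightarrow> (\<Sum>d\<in>D. p d * Q d e) = p e"
    and L2: "\<And>d. d \<in> D \<Longrightarrow> integrable (P d) (\<lambda>w. (Z w)\<^sup>2)"
    and mean: "\<And>d. d \<in> D \<Longrightarrow> (\<integral>w. Z w \<partial>P d) = 0"
  shows "(\<lambda>n. cf (t / sqrt (real n)) n x) \<longlonglongrightarrow> of_real (exp (- t\<^sup>2 * (\<Sum>d\<in>D. p d * (\<integral>w. (Z w)\<^sup>2 \<partial>P d)) / 2))"
proof -
  define b where "b d = (\<integral>w. (Z w)\<^sup>2 \<partial>P d)" for d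
  define v where "v = (\<Sum>d\<in>D. p d * b d)"
  define s where "s n = t / sqrt (real (Suc n))" for n
  have s_lim: "s \<longlonglongrightarrow> 0" unfolding s_def by real_asymp
  have DS: "d \<in> S" if "d \<in> D" for d using that D_subset by auto
  interpret Q: irreducible_stochastic_matrix D Q
  proof
    show "(\<Sum>e\<in>D. Q d e) = 1" if "d \<in> D" for d by (rule chain_trans_row_sum[OF DS[OF that]])
  qed (use chain_irreducible in \<open>auto simp: chain_trans_def\<close>)
  have v: "0 \<le> v" unfolding v_def b_def using p(1) by (intro sum_nonneg mult_nonneg_nonneg) auto
  have D_lim: "(\<lambda>n. cf (s n) n d) \<longlonglongrightarrow> of_real (exp (- t\<^sup>2 * v / 2))" if d: "d \<in> D" for d
  proof (rule perturbed_matrix_power_limit[where M = "\<lambda>n. kern (s n)" and Q = Q and b = b and \<phi> = "\<lambda>n. cf (s n)" and D = D])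
    show "(\<Sum>e\<in>D. norm (kern (s n) d e)) \<le> 1" if "d \<in> D" for n d
      using sum_mono[of D "\<lambda>e. norm (kern (s n) d e)" "Q d"] norm_kern_le chain_trans_row_sum DS[OF that] by simp
    show "(\<lambda>n. of_nat (Suc n) * ((\<Sum>e\<in>D. kern (s n) d e) - 1)) \<longlonglongrightarrow> of_real (- t\<^sup>2 / 2 * b d)" if "d \<in> D" for d
      unfolding s_def b_def by (rule char_step_expansion[OF DS L2 mean]) (use that in auto)
    show "\<exists>c. \<forall>d\<in>D. \<bar>c d - (\<Sum>e\<in>D. Q d e * c e) - (v - b d) / 2\<bar> \<le> \<eta>" if "0 < \<eta>" for \<eta>
    proof (rule Q.poisson_equation_approx[OF p(1,2,3) _ that])
      \<comment> \<open>The variance \<open>v\<close> is the \<open>p\<close>-mean of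
        \<open>b\<close>, which is exactly the solvability condition of the Poisson
        equation.\<close>
      have "(\<Sum>d\<in>D. p d * ((v - b d) / 2)) = ((\<Sum>d\<in>D. p d) * v - (\<Sum>d\<in>D. p d * b d)) / 2"
        by (simp add: right_diff_distrib sum_subtractf sum_distrib_right flip: sum_divide_distrib)
      then show "(\<Sum>d\<in>D. p d * ((v - b d) / 2)) = 0" by (simp add: p(2) v_def)
    qed
  qed (use d DS in \<open>auto intro: cf_0 cf_Suc kern_tendsto s_lim v\<close>)
  have "(\<lambda>n. cf (s n) (Suc n) x) \<longlonglongrightarrow> (\<Sum>d\<in>D. of_real (Q x d) * of_real (exp (- t\<^sup>2 * v / 2)))"
    unfolding cf_Suc[OF x] by (intro tendsto_sum tendsto_mult kern_tendsto[OF x s_lim] D_lim)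
  also have "(\<Sum>d\<in>D. of_real (Q x d) * of_real (exp (- t\<^sup>2 * v / 2))) = complex_of_real ((\<Sum>d\<in>D. Q x d) * exp (- t\<^sup>2 * v / 2))"
    by (simp add: sum_distrib_right)
  also have "\<dots> = of_real (exp (- t\<^sup>2 * v / 2))" by (simp add: chain_trans_row_sum[OF x])
  finally have "(\<lambda>n. cf (t / sqrt (real (Suc n))) (Suc n) x) \<longlonglongrightarrow> of_real (exp (- t\<^sup>2 * v / 2))"
    unfolding s_def .
  then show ?thesis unfolding v_def b_def by (rule LIMSEQ_imp_Suc)
qed

end

section \<open>The limit law and general initial distributions\<close>

lemma char_normal_law:
  assumes "0 \<le> v"
  shows "char (normal_law v) t = of_real (exp (- t\<^sup>2 * v / 2))" and "real_distribution (normal_law v)"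
proof -
  have "char (normal_law v) t = of_real (exp (- t\<^sup>2 * v / 2)) \<and> real_distribution (normal_law v)"
  proof (cases "v = 0")
    case True
    interpret prob_space "return borel (0::real)" by (rule prob_space_return) simp
    show ?thesis
      using True by (auto simp: normal_law_def char_def integral_return real_distribution_def
          real_distribution_axioms_def prob_space_axioms)
  next
    case False
    then have v: "0 < sqrt v" using assms by simp
    interpret std: real_distribution std_normal_distribution by (rule real_dist_normal_dist)
    interpret prob_space "density lborel (normal_density 0 (sqrt v))" by (rule prob_space_normal_density[OF v])
    have "distributed std_normal_distribution lborel (\<lambda>x. x) std_normal_density"
      unfolding distributed_def by (auto simp: distr_id2)
    from std.normal_density_affine[OF this zero_less_one less_imp_neq[OF v, symmetric], of 0]
    have "distributed std_normal_distribution lborel (\<lambda>x. sqrt v * x) (normal_density 0 (sqrt v))"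
      using v by simp
    then have eq: "density lborel (normal_density 0 (sqrt v)) = distr std_normal_distribution lborel (\<lambda>x. sqrt v * x)"
      by (simp add: distributed_distr_eq_density)
    have "char (normal_law v) t = char std_normal_distribution (t * sqrt v)"
      using False unfolding normal_law_def eq char_def by (simp add: integral_distr mult.assoc)
    also have "\<dots> = of_real (exp (- t\<^sup>2 * v / 2))"
      using assms by (simp add: char_std_normal_distribution power_mult_distrib)
    finally show ?thesis
      using False by (auto simp: normal_law_def real_distribution_def real_distribution_axioms_def prob_space_axioms)
  qed
  then show "char (normal_law v) t = of_real (exp (- t\<^sup>2 * v / 2))" "real_distribution (normal_law v)" by auto
qed

context recurrent_diffusion
begin

text \<open>Both parts are proved together: finiteness of the next hitting time is read off the
  shifted path, which the second part identifies. The hitting time of index \<open>n + 2\<close>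
  belongs to \<open>n + 1\<close> iterations, as \<open>tau D 2\<close> is the first switch.\<close>

lemma shift_tau_eq:
  assumes w: "w \<in> Omega S"
  shows "tau D (Suc (Suc n)) w < \<infinity> \<longleftrightarrow> (\<forall>j\<le>n. \<tau> ((\<theta> ^^ j) w) < \<infinity>)"
    and "tau D (Suc (Suc n)) w < \<infinity> \<Longrightarrow> shift (tau D (Suc (Suc n))) w = (\<theta> ^^ Suc n) w"
proof (induction n)
  case 0
  { case 1 show ?case by (simp add: numeral_2_eq_2) }
  { case 2 show ?case by (simp add: numeral_2_eq_2) }
next
  case (Suc n)
  have *: "tau D (Suc (Suc (Suc n))) w < \<infinity> \<longleftrightarrow>
      tau D (Suc (Suc n)) w < \<infinity> \<and> \<tau> (shift (tau D (Suc (Suc n))) w) < \<infinity>"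
  proof (cases "tau D (Suc (Suc n)) w < \<infinity>")
    case True
    then obtain t where "tau D (Suc (Suc n)) w = ereal t"
      using tau_Suc_cases[OF Omega_continuous_on[OF w] finite_D, of "Suc n"] by auto
    then show ?thesis
      using tau_Suc_Suc_shift[OF w finite_D True] by auto
  next
    case False
    then show ?thesis using tau_Suc_Suc_infinite[of D "Suc n" w] by simp
  qed
  { case 1 show ?case
      using * Suc.IH by (auto simp: le_Suc_eq simp del: funpow.simps) }
  { case 2
    then have "tau D (Suc (Suc n)) w < \<infinity>" using * by blast
    then show ?case
      using shift_tau_Suc_Suc[OF w finite_D _ 2] Suc.IH(2) by simp }
qed

text \<open>Finiteness and value are both expressed through iterates of \<open>\<theta>\<close>,
  which reduces measurability to that of \<open>tau D 2\<close>; on infinite times the shift is the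
  identity.\<close>

lemma measurable_shift_tau:
  "shift (tau D (Suc (Suc n))) \<in> measurable (FF S) (FF S)"
proof -
  have [measurable]: "(\<lambda>w. w) \<in> measurable (FF S) (FF S)" by simp
  have "(\<lambda>w. if \<forall>j\<le>n. \<tau> ((\<theta> ^^ j) w) < \<infinity> then (\<theta> ^^ Suc n) w else w) \<in> measurable (FF S) (FF S)"
    by (intro measurable_If measurable_shift_funpow) measurable
  also have "?this \<longleftrightarrow> ?thesis"
  proof (rule measurable_cong)
    fix w assume "w \<in> space (FF S)"
    then have w: "w \<in> Omega S" by (simp add: space_FF)
    have "shift (tau D (Suc (Suc n))) w = w" if "\<not> tau D (Suc (Suc n)) w < \<infinity>"
      using that by (simp add: shift_def)
    then show "(if \<forall>j\<le>n. \<tau> ((\<theta> ^^ j) w) < \<infinity> then (\<theta> ^^ Suc n) w else w) = shift (tau D (Suc (Suc n))) w"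
      using shift_tau_eq[OF w, of n] by (auto simp del: funpow.simps)
  qed
  finally show ?thesis .
qed

text \<open>\<open>P\<close> is a kernel on \<open>S\<close> only, hence the restriction of
  \<open>\<mu>\<close>. As a monadic bind the mixture has an integral formula.\<close>

lemma Pmix_eq_bind:
  assumes \<mu>: "prob_space \<mu>" "sets \<mu> = sets borel" "emeasure \<mu> S = 1"
  shows "Pmix S P \<mu> = restrict_space \<mu> S \<bind> P" (is "_ = ?B")
    and "prob_space (restrict_space \<mu> S)"
    and "P \<in> measurable (restrict_space \<mu> S) (subprob_algebra (FF S))"
proof -
  have S\<mu>: "S \<in> sets \<mu>" using S_borel \<mu> by simp
  have space_\<mu>: "space (restrict_space \<mu> S) = S"
    using sets.sets_into_space[OF S\<mu>] by (auto simp: space_restrict_space)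
  show prob: "prob_space (restrict_space \<mu> S)"
    using \<mu>(3) S\<mu> by (intro prob_spaceI) (simp add: space_\<mu> emeasure_restrict_space)
  show P: "P \<in> measurable (restrict_space \<mu> S) (subprob_algebra (FF S))"
  proof (rule measurable_subprob_algebra)
    fix A assume "A \<in> sets (FF S)"
    then have "(\<lambda>x. emeasure (P x) A) \<in> borel_measurable (restrict_space borel S)"
      using markov by (auto simp: strong_markov_family_def)
    also have "borel_measurable (restrict_space borel S) = borel_measurable (restrict_space \<mu> S)"
      by (intro measurable_cong_sets sets_restrict_space_cong) (simp_all add: \<mu>(2))
    finally show "(\<lambda>x. emeasure (P x) A) \<in> borel_measurable (restrict_space \<mu> S)" .
  qed (auto simp: space_\<mu> sets_P prob_space_P prob_space_imp_subprob_space)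
  have ne: "space (restrict_space \<mu> S) \<noteq> {}" by (rule prob_space.not_empty[OF prob])
  have sets_B: "sets ?B = sets (FF S)" by (rule sets_bind_measurable[OF P ne])
  have space_B: "space ?B = Omega S" using sets_eq_imp_space_eq[OF sets_B] by (simp add: space_FF)
  have "Pmix S P \<mu> = measure_of (space ?B) (sets ?B) (emeasure ?B)"
    unfolding Pmix_def space_B sets_B
  proof (rule measure_of_eq)
    show "sets (FF S) \<subseteq> Pow (Omega S)" using sets.sets_into_space space_FF by blast
    fix A assume "A \<in> sigma_sets (Omega S) (sets (FF S))"
    then have A: "A \<in> sets (FF S)" using sets.sigma_sets_eq[of "FF S"] by (simp add: space_FF)
    have "emeasure ?B A = (\<integral>\<^sup>+ x. emeasure (P x) A \<partial>restrict_space \<mu> S)"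
      by (rule emeasure_bind[OF ne P A])
    also have "\<dots> = (\<integral>\<^sup>+ x. emeasure (P x) A * indicator S x \<partial>\<mu>)"
      using S\<mu> by (intro nn_integral_restrict_space) (simp add: sets.Int_space_eq2)
    finally show "(\<integral>\<^sup>+ x. indicator S x * emeasure (P x) A \<partial>\<mu>) = emeasure ?B A" by (simp add: mult.commute)
  qed
  then show "Pmix S P \<mu> = ?B" by (simp only: measure_of_of_measure)
qed

end

context recurrent_diffusion_functional
begin

lemma AE_sum_eq_partial_sum:
  assumes x: "x \<in> S"
  shows "AE w in P x. (\<Sum>k=1..n. if k = 1 then Z w else Z (shift (tau D k) w)) = partial_sum n w"
  using AE_all_tau_finite[OF x] AE_space
proof eventually_elim
  case (elim w)
  then have w: "w \<in> Omega S" by (simp add: space_P[OF x])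
  have "(\<Sum>k=1..n. if k = 1 then Z w else Z (shift (tau D k) w)) =
      (\<Sum>k<n. if Suc k = 1 then Z w else Z (shift (tau D (Suc k)) w))"
    by (rule sum.reindex_bij_witness[where i = Suc and j = "\<lambda>k. k - 1"]) auto
  also have "\<dots> = (\<Sum>k<n. Z ((\<theta> ^^ k) w))"
  proof (rule sum.cong[OF refl])
    fix k
    show "(if Suc k = 1 then Z w else Z (shift (tau D (Suc k)) w)) = Z ((\<theta> ^^ k) w)"
      \<comment> \<open>For \<open>k = 0\<close> both sides are \<open>Z w\<close>; for
        \<open>k = Suc m\<close> the hitting time has index \<open>m + 2\<close> and
        \<open>shift_tau_eq\<close> is used at \<open>m\<close>.\<close>
      using shift_tau_eq[OF w, of "k - 1"] elim(1) by (cases k) (auto simp del: funpow.simps(2))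
  qed
  finally show ?case by (simp add: partial_sum_def)
qed

end

text \<open>Real and imaginary parts are bounded by 1, and the iterated integral is obtained for
  each separately. The second claim provides the measurability in the starting point used for
  dominated convergence.\<close>

lemma complex_integral_bind:
  fixes f :: "'a \<Rightarrow> complex"
  assumes M: "prob_space M" and N: "N \<in> measurable M (subprob_algebra K)"
    and f: "f \<in> borel_measurable K" "\<And>x. norm (f x) \<le> 1"
    and prob: "\<And>x. x \<in> space M \<Longrightarrow> prob_space (N x)"
  shows "(\<integral>y. f y \<partial>(M \<bind> N)) = (\<integral>x. (\<integral>y. f y \<partial>N x) \<partial>M)"
    and "(\<lambda>x. \<integral>y. f y \<partial>N x) \<in> borel_measurable M"
proof -
  interpret M: prob_space M by fact
  have sets_N: "sets (N x) = sets K" if "x \<in> space M" for x by (rule sets_kernel[OF N that])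
  have int_N: "integrable (N x) f" if x: "x \<in> space M" for x
  proof -
    interpret prob_space "N x" by (rule prob[OF x])
    show ?thesis using f measurable_cong_sets[OF sets_N[OF x] refl] by (intro integrable_const_bound[of _ 1]) auto
  qed
  interpret MN: prob_space "M \<bind> N" by (rule M.prob_space_bind[OF AE_I2 N]) (rule prob)
  have "sets (M \<bind> N) = sets K" by (rule sets_bind_measurable[OF N M.not_empty])
  then have int: "integrable (M \<bind> N) f"
    using f measurable_cong_sets by (intro MN.integrable_const_bound[of _ 1]) blast+
  have bnd: "AE x in M. emeasure (N x) (space (N x)) \<le> ennreal 1"
    using prob by (intro AE_I2) (simp add: prob_space.emeasure_space_1)
  have Re1: "\<bar>Re (f y)\<bar> \<le> 1" "\<bar>Im (f y)\<bar> \<le> 1" for y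
    using f(2)[of y] abs_Re_le_cmod[of "f y"] abs_Im_le_cmod[of "f y"] by linarith+
  have mR: "(\<lambda>y. Re (f y)) \<in> borel_measurable K" "(\<lambda>y. Im (f y)) \<in> borel_measurable K"
    using f(1) by measurable
  have ReN: "Re (\<integral>y. f y \<partial>N x) = (\<integral>y. Re (f y) \<partial>N x)" "Im (\<integral>y. f y \<partial>N x) = (\<integral>y. Im (f y) \<partial>N x)"
    if "x \<in> space M" for x using int_N[OF that] by simp_all
  have meas: "(\<lambda>x. \<integral>y. Re (f y) \<partial>N x) \<in> borel_measurable M" "(\<lambda>x. \<integral>y. Im (f y) \<partial>N x) \<in> borel_measurable M"
    by (rule measurable_compose[OF N integral_measurable_subprob_algebra[OF mR(1)]],
        rule measurable_compose[OF N integral_measurable_subprob_algebra[OF mR(2)]])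
  show m: "(\<lambda>x. \<integral>y. f y \<partial>N x) \<in> borel_measurable M"
    unfolding borel_measurable_complex_iff
    using meas ReN by (simp cong: measurable_cong_simp)
  have int2: "integrable M (\<lambda>x. \<integral>y. f y \<partial>N x)"
  proof (rule M.integrable_const_bound[OF _ m])
    show "AE x in M. norm (\<integral>y. f y \<partial>N x) \<le> 1"
    proof (rule AE_I2)
      fix x assume x: "x \<in> space M"
      interpret prob_space "N x" by (rule prob[OF x])
      have "norm (\<integral>y. f y \<partial>N x) \<le> (\<integral>y. norm (f y) \<partial>N x)" by (rule integral_norm_bound)
      also have "\<dots> \<le> (\<integral>y. 1 \<partial>N x)" using int_N[OF x] f(2) by (intro integral_mono) auto
      finally show "norm (\<integral>y. f y \<partial>N x) \<le> 1" by (simp add: prob_space)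
    qed
  qed
  have "Re (\<integral>y. f y \<partial>(M \<bind> N)) = (\<integral>x. \<integral>y. Re (f y) \<partial>N x \<partial>M)"
    using int integral_bind[OF mR(1) Re1(1) N M.finite_measure_axioms bnd] by simp
  moreover have "Im (\<integral>y. f y \<partial>(M \<bind> N)) = (\<integral>x. \<integral>y. Im (f y) \<partial>N x \<partial>M)"
    using int integral_bind[OF mR(2) Re1(2) N M.finite_measure_axioms bnd] by simp
  moreover have "Re (\<integral>x. (\<integral>y. f y \<partial>N x) \<partial>M) = (\<integral>x. \<integral>y. Re (f y) \<partial>N x \<partial>M)"
    unfolding integral_Re[OF int2, symmetric] by (rule Bochner_Integration.integral_cong[OF refl ReN(1)])
  moreover have "Im (\<integral>x. (\<integral>y. f y \<partial>N x) \<partial>M) = (\<integral>x. \<integral>y. Im (f y) \<partial>N x \<partial>M)"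
    unfolding integral_Im[OF int2, symmetric] by (rule Bochner_Integration.integral_cong[OF refl ReN(2)])
  ultimately show "(\<integral>y. f y \<partial>(M \<bind> N)) = (\<integral>x. (\<integral>y. f y \<partial>N x) \<partial>M)"
    by (simp add: complex_eq_iff)
qed

theorem theoremA2:
  fixes S D :: "real set" and P :: "real \<Rightarrow> path measure" and Z :: "path \<Rightarrow> real"
    and p :: "real \<Rightarrow> real" and \<mu> :: "real measure"
  assumes S: "S = UNIV \<or> S = {0..} \<or> S = {0<..}"
    and D: "finite D" "D \<subseteq> S" "card D \<ge> 2"
    and diff: "strong_markov_family S P"
    and rec: "recurrent S P"
    and p_prob: "\<forall>d\<in>D. 0 \<le> p d" "(\<Sum>d\<in>D. p d) = 1"
    and p_inv: "\<forall>d'\<in>D. (\<Sum>d\<in>D. p d * chain_trans S P D d d') = p d'"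
    and Z_meas: "Z \<in> borel_measurable (Ftau S (tau D 2))"
    and Z_bdd: "\<exists>c. \<forall>w\<in>Omega S. c \<le> Z w"
    and Z_L2: "\<forall>d\<in>D. integrable (P d) (\<lambda>w. (Z w)\<^sup>2)"
    and Z_mean: "\<forall>d\<in>D. (\<integral>w. Z w \<partial>P d) = 0"
    and \<mu>: "prob_space \<mu>" "sets \<mu> = sets borel" "emeasure \<mu> S = 1"
  shows "weak_conv_m
           (\<lambda>n. distr (Pmix S P \<mu>) borel
                  (\<lambda>w. (\<Sum>k=1..n. (if k = 1 then Z w else Z (shift (tau D k) w))) / sqrt (real n)))
           (normal_law (\<Sum>d\<in>D. p d * (\<integral>w. (Z w)\<^sup>2 \<partial>P d)))"
proof -
  have "S \<in> sets borel" using S by auto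
  then interpret recurrent_diffusion_functional S D P Z
    using D diff rec Z_meas by unfold_locales
  define v where "v = (\<Sum>d\<in>D. p d * (\<integral>w. (Z w)\<^sup>2 \<partial>P d))"
  have v: "0 \<le> v" unfolding v_def using p_prob(1) by (intro sum_nonneg mult_nonneg_nonneg) auto
  define G where "G n w = (\<Sum>k=1..n. (if k = 1 then Z w else Z (shift (tau D k) w))) / sqrt (real n)" for n w
  note bind = Pmix_eq_bind[OF \<mu>]
  interpret \<mu>: prob_space "restrict_space \<mu> S" by (rule bind(2))
  have space_\<mu>: "space (restrict_space \<mu> S) = S"
    using sets_eq_imp_space_eq[OF \<mu>(2)] by (simp add: space_restrict_space)
  have sets_mix: "sets (Pmix S P \<mu>) = sets (FF S)"
    unfolding bind(1) by (rule sets_bind_measurable[OF bind(3) \<mu>.not_empty])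
  interpret mix: prob_space "Pmix S P \<mu>"
    unfolding bind(1) by (rule \<mu>.prob_space_bind[OF AE_I2 bind(3)]) (simp add: space_\<mu> prob_space_P)
  have Zk: "(\<lambda>w. if k = 1 then Z w else Z (shift (tau D k) w)) \<in> borel_measurable (FF S)" if "k \<ge> 1" for k
  proof (cases "k = 1")
    case True
    show ?thesis unfolding if_P[OF True] by (rule measurable_Z)
  next
    case False
    define m where "m = k - 2"
    have k: "k = Suc (Suc m)" using False that by (simp add: m_def)
    show ?thesis
      unfolding if_not_P[OF False] unfolding k by (rule measurable_compose[OF measurable_shift_tau measurable_Z])
  qed
  have G: "G n \<in> borel_measurable (FF S)" for n
  proof -
    have "(\<lambda>w. \<Sum>k=1..n. if k = 1 then Z w else Z (shift (tau D k) w)) \<in> borel_measurable (FF S)"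
    proof (rule borel_measurable_sum)
      fix k assume "k \<in> {1..n}"
      then show "(\<lambda>w. if k = 1 then Z w else Z (shift (tau D k) w)) \<in> borel_measurable (FF S)"
        by (intro Zk) simp
    qed
    then have "(\<lambda>w. (\<Sum>k=1..n. if k = 1 then Z w else Z (shift (tau D k) w)) / sqrt (real n)) \<in> borel_measurable (FF S)"
      by (rule borel_measurable_divide) (rule borel_measurable_const)
    then show ?thesis unfolding G_def .
  qed
  have G': "G n \<in> borel_measurable (Pmix S P \<mu>)" for n
    using G measurable_cong_sets[OF sets_mix refl] by blast
  \<comment> \<open>The sum over hitting times is exchanged for \<open>partial_sum\<close> under
    each \<open>P x\<close> separately, where the null set is controlled; \<open>n = 0\<close> fits
    since division by \<open>sqrt 0\<close> gives 0.\<close>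
  have G_P: "(\<integral>w. iexp (t * G n w) \<partial>P x) = cf (t / sqrt (real n)) n x" if x: "x \<in> S" for n t x
    unfolding cf_def
  proof (rule integral_cong_AE)
    note [measurable_cong] = sets_P[OF x]
    note [measurable] = G measurable_partial_sum
    show "(\<lambda>w. iexp (t * G n w)) \<in> borel_measurable (P x)" by measurable
    show "(\<lambda>w. iexp (t / sqrt (real n) * partial_sum n w)) \<in> borel_measurable (P x)" by measurable
    show "AE w in P x. iexp (t * G n w) = iexp (t / sqrt (real n) * partial_sum n w)"
      using AE_sum_eq_partial_sum[OF x, of n] by eventually_elim (simp add: G_def)
  qed
  have iexp_G: "(\<lambda>w. iexp (t * G n w)) \<in> borel_measurable (FF S)" for t n
    using G by measurable
  have char_G: "char (distr (Pmix S P \<mu>) borel (G n)) t = (\<integral>x. cf (t / sqrt (real n)) n x \<partial>restrict_space \<mu> S)"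
    and cf_meas: "cf (t / sqrt (real n)) n \<in> borel_measurable (restrict_space \<mu> S)" for n t
  proof -
    note ib = complex_integral_bind[OF bind(2,3) iexp_G[of t n]]
    have "char (distr (Pmix S P \<mu>) borel (G n)) t = (\<integral>w. iexp (t * G n w) \<partial>Pmix S P \<mu>)"
      unfolding char_def by (rule integral_distr[OF G']) simp
    also have "\<dots> = (\<integral>x. (\<integral>w. iexp (t * G n w) \<partial>P x) \<partial>restrict_space \<mu> S)"
      unfolding bind(1) by (rule ib(1)) (simp_all add: space_\<mu> prob_space_P)
    also have "\<dots> = (\<integral>x. cf (t / sqrt (real n)) n x \<partial>restrict_space \<mu> S)"
      by (rule Bochner_Integration.integral_cong[OF refl], rule G_P) (simp only: space_\<mu>)
    finally show "char (distr (Pmix S P \<mu>) borel (G n)) t = (\<integral>x. cf (t / sqrt (real n)) n x \<partial>restrict_space \<mu> S)" .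
    have "(\<lambda>x. \<integral>w. iexp (t * G n w) \<partial>P x) \<in> borel_measurable (restrict_space \<mu> S)"
      by (rule ib(2)) (simp_all add: space_\<mu> prob_space_P)
    also have "?this \<longleftrightarrow> cf (t / sqrt (real n)) n \<in> borel_measurable (restrict_space \<mu> S)"
      by (rule measurable_cong, rule G_P) (simp only: space_\<mu>)
    finally show "cf (t / sqrt (real n)) n \<in> borel_measurable (restrict_space \<mu> S)" .
  qed
  have cf_le: "norm (cf s n x) \<le> 1" if x: "x \<in> S" for s n x
  proof -
    interpret prob_space "P x" by (rule prob_space_P[OF x])
    have "norm (cf s n x) \<le> (\<integral>w. norm (iexp (s * partial_sum n w)) \<partial>P x)"
      unfolding cf_def by (rule integral_norm_bound)
    then show ?thesis by (simp add: prob_space)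
  qed
  have "weak_conv_m (\<lambda>n. distr (Pmix S P \<mu>) borel (G n)) (normal_law v)"
  proof (rule levy_continuity)
    show "real_distribution (distr (Pmix S P \<mu>) borel (G n))" for n
      by (rule mix.real_distribution_distr[OF G'])
    show "real_distribution (normal_law v)" by (rule char_normal_law(2)[OF v])
    fix t
    \<comment> \<open>The limit of \<open>cf\<close> is the same constant for every starting point
      and \<open>cf\<close> is bounded by 1, so dominated convergence in \<open>x\<close> removes
      the dependence on \<open>\<mu>\<close>.\<close>
    have "(\<lambda>n. \<integral>x. cf (t / sqrt (real n)) n x \<partial>restrict_space \<mu> S) \<longlonglongrightarrow>
        (\<integral>x. of_real (exp (- t\<^sup>2 * v / 2)) \<partial>restrict_space \<mu> S)"
    proof (rule integral_dominated_convergence[where w = "\<lambda>_. 1"])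
      show "AE x in restrict_space \<mu> S. (\<lambda>n. cf (t / sqrt (real n)) n x) \<longlonglongrightarrow> of_real (exp (- t\<^sup>2 * v / 2))"
        unfolding v_def using p_prob p_inv Z_L2 Z_mean
        by (intro AE_I2 cf_tendsto) (simp_all add: space_\<mu>)
      show "AE x in restrict_space \<mu> S. norm (cf (t / sqrt (real n)) n x) \<le> 1" for n
        by (rule AE_I2) (simp add: space_\<mu> cf_le)
    qed (use cf_meas in auto)
    then show "(\<lambda>n. char (distr (Pmix S P \<mu>) borel (G n)) t) \<longlonglongrightarrow> char (normal_law v) t"
      unfolding char_G char_normal_law(1)[OF v] by (simp add: \<mu>.prob_space)
  qed
  then show ?thesis unfolding G_def v_def .
qed

end
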